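(* Let $k$ be a field, let $c,d$ be positive integers, and put $e=c+d$, $a=cd$. Then there are short local $k$-algebras of Hilbert type $(e,a)$ (even commutative ones) having a Koszul module of Loewy length at most $2$ with dimension vector $(1,c)$.
   Context: A short local $k$-algebra is a finite-dimensional local $k$-algebra $A$ whose radical $J$ satisfies $J^3=0$; we assume $A/J=k$. Its Hilbert type is $(e,a)$ with $e=|J/J^2|$, $a=|J^2|$ (lengths). Modules are left modules of finite length. A module $M$ has Loewy length at most $2$ iff $J^2M=0$; for such $M$ the dimension vector is $(|M/JM|,|JM|)$. A module $M$ is a Koszul module if a minimal projective resolution $\cdots\to P_n\to P_{n-1}\to\cdots\to P_0\to M\to 0$ induces for every $n\ge 0$ an exact sequence $$0\to P_n/JP_n\to JP_{n-1}/J^2P_{n-1}\to\cdots\to J^nP_0/J^{n+1}P_0\to J^nM/J^{n+1}M\to 0.$$ *)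

theory Defs
  imports "HOL-Algebra.Module" "HOL-Algebra.QuotRing" "HOL-Algebra.Ideal_Product"
begin

text \<open>Unital left modules over a ring that need not be commutative (the locale
  \<^locale>\<open>module\<close> presupposes a commutative ring).  Modules are records of type
  \<^type>\<open>module\<close>; their fields \<^const>\<open>mult\<close> and \<^const>\<open>one\<close> are never used.
  Submodules are given by the locale \<^locale>\<open>submodule\<close>, which makes no commutativity
  assumption.\<close>

locale left_module = R?: ring R + M?: abelian_group M for R (structure) and M (structure) +
  assumes smult_closed [simp, intro]:
      "\<lbrakk>a \<in> carrier R; x \<in> carrier M\<rbrakk> \<Longrightarrow> a \<odot>\<^bsub>M\<^esub> x \<in> carrier M"
    and smult_l_distr:
      "\<lbrakk>a \<in> carrier R; b \<in> carrier R; x \<in> carrier M\<rbrakk> \<Longrightarrow>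
        (a \<oplus>\<^bsub>R\<^esub> b) \<odot>\<^bsub>M\<^esub> x = a \<odot>\<^bsub>M\<^esub> x \<oplus>\<^bsub>M\<^esub> b \<odot>\<^bsub>M\<^esub> x"
    and smult_r_distr:
      "\<lbrakk>a \<in> carrier R; x \<in> carrier M; y \<in> carrier M\<rbrakk> \<Longrightarrow>
        a \<odot>\<^bsub>M\<^esub> (x \<oplus>\<^bsub>M\<^esub> y) = a \<odot>\<^bsub>M\<^esub> x \<oplus>\<^bsub>M\<^esub> a \<odot>\<^bsub>M\<^esub> y"
    and smult_assoc:
      "\<lbrakk>a \<in> carrier R; b \<in> carrier R; x \<in> carrier M\<rbrakk> \<Longrightarrow>
        (a \<otimes>\<^bsub>R\<^esub> b) \<odot>\<^bsub>M\<^esub> x = a \<odot>\<^bsub>M\<^esub> (b \<odot>\<^bsub>M\<^esub> x)"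
    and smult_one [simp]: "x \<in> carrier M \<Longrightarrow> \<one>\<^bsub>R\<^esub> \<odot>\<^bsub>M\<^esub> x = x"

definition mod_hom ::
    "('a, 'r) ring_scheme \<Rightarrow> ('a, 'b, 'm) module_scheme \<Rightarrow> ('a, 'c, 'n) module_scheme \<Rightarrow> ('b \<Rightarrow> 'c) set"
  where "mod_hom A M N = {f \<in> carrier M \<rightarrow> carrier N.
    (\<forall>x\<in>carrier M. \<forall>y\<in>carrier M. f (x \<oplus>\<^bsub>M\<^esub> y) = f x \<oplus>\<^bsub>N\<^esub> f y) \<and>
    (\<forall>a\<in>carrier A. \<forall>x\<in>carrier M. f (a \<odot>\<^bsub>M\<^esub> x) = a \<odot>\<^bsub>N\<^esub> f x)}"

definition quot_mod :: "('a, 'b, 'm) module_scheme \<Rightarrow> 'b set \<Rightarrow> ('a, 'b set) module"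
  where "quot_mod M N =
    \<lparr>carrier = a_rcosets\<^bsub>M\<^esub> N, mult = undefined, one = undefined, zero = N, add = set_add M,
     smult = (\<lambda>a X. N <+>\<^bsub>M\<^esub> ((\<lambda>x. a \<odot>\<^bsub>M\<^esub> x) ` X))\<rparr>"

text \<open>The map \<open>M/U \<rightarrow> N/V\<close> induced by a homomorphism \<open>f\<close> with \<open>f U \<subseteq> V\<close>: the coset
  \<open>U + x\<close> goes to \<open>V + f U + f x = V + f x\<close>.\<close>

definition induced_map ::
    "('a, 'c, 'n) module_scheme \<Rightarrow> 'c set \<Rightarrow> ('b \<Rightarrow> 'c) \<Rightarrow> 'b set \<Rightarrow> 'c set"
  where "induced_map N V f X = V <+>\<^bsub>N\<^esub> (f ` X)"

text \<open>\<open>M\<close> has length \<open>n\<close>: there is a composition series with \<open>n\<close> factors.\<close>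

definition has_length :: "('a, 'r) ring_scheme \<Rightarrow> ('a, 'b, 'm) module_scheme \<Rightarrow> nat \<Rightarrow> bool"
  where "has_length A M n \<longleftrightarrow> (\<exists>s :: nat \<Rightarrow> 'b set.
    s 0 = {\<zero>\<^bsub>M\<^esub>} \<and> s n = carrier M \<and> (\<forall>i\<le>n. submodule (s i) A M) \<and>
    (\<forall>i<n. s i \<subset> s (Suc i) \<and> \<not> (\<exists>U. submodule U A M \<and> s i \<subset> U \<and> U \<subset> s (Suc i))))"

definition regular_module :: "('a, 'r) ring_scheme \<Rightarrow> ('a, 'a) module"
  where "regular_module A =
    \<lparr>carrier = carrier A, mult = mult A, one = one A, zero = zero A, add = add A, smult = mult A\<rparr>"

definition maximal_left_ideal :: "('a, 'r) ring_scheme \<Rightarrow> 'a set \<Rightarrow> bool"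
  where "maximal_left_ideal A m \<longleftrightarrow>
    submodule m A (regular_module A) \<and> m \<noteq> carrier A \<and>
    (\<forall>L. submodule L A (regular_module A) \<and> m \<subseteq> L \<longrightarrow> L = m \<or> L = carrier A)"

definition radical :: "('a, 'r) ring_scheme \<Rightarrow> 'a set"
  where "radical A = carrier A \<inter> \<Inter>{m. maximal_left_ideal A m}"

definition local_ring :: "('a, 'r) ring_scheme \<Rightarrow> bool"
  where "local_ring A \<longleftrightarrow> ring A \<and> (\<exists>!m. maximal_left_ideal A m)"

primrec rad_pow :: "('a, 'r) ring_scheme \<Rightarrow> nat \<Rightarrow> 'a set"
  where "rad_pow A 0 = carrier A"
  | "rad_pow A (Suc n) = ideal_prod A (radical A) (rad_pow A n)"

text \<open>The submodule \<open>I M\<close>, for an ideal \<open>I\<close>.\<close>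

inductive_set ideal_smult :: "'a set \<Rightarrow> ('a, 'b, 'm) module_scheme \<Rightarrow> 'b set"
  for I and M where
    smult: "\<lbrakk>i \<in> I; x \<in> carrier M\<rbrakk> \<Longrightarrow> i \<odot>\<^bsub>M\<^esub> x \<in> ideal_smult I M"
  | sum: "\<lbrakk>x \<in> ideal_smult I M; y \<in> ideal_smult I M\<rbrakk> \<Longrightarrow> x \<oplus>\<^bsub>M\<^esub> y \<in> ideal_smult I M"

abbreviation rad_mod :: "('a, 'r) ring_scheme \<Rightarrow> nat \<Rightarrow> ('a, 'b, 'm) module_scheme \<Rightarrow> 'b set"
  where "rad_mod A n M \<equiv> ideal_smult (rad_pow A n) M"

definition k_algebra :: "('k, 'x) ring_scheme \<Rightarrow> ('k, 'a, 'm) module_scheme \<Rightarrow> bool"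
  where "k_algebra K A \<longleftrightarrow> field K \<and> ring A \<and> module K A \<and>
    (\<forall>l\<in>carrier K. \<forall>x\<in>carrier A. \<forall>y\<in>carrier A.
      (l \<odot>\<^bsub>A\<^esub> x) \<otimes>\<^bsub>A\<^esub> y = l \<odot>\<^bsub>A\<^esub> (x \<otimes>\<^bsub>A\<^esub> y) \<and> x \<otimes>\<^bsub>A\<^esub> (l \<odot>\<^bsub>A\<^esub> y) = l \<odot>\<^bsub>A\<^esub> (x \<otimes>\<^bsub>A\<^esub> y))"

definition finite_dimensional :: "('k, 'x) ring_scheme \<Rightarrow> ('k, 'a, 'm) module_scheme \<Rightarrow> bool"
  where "finite_dimensional K V \<longleftrightarrow> (\<exists>B. finite B \<and> B \<subseteq> carrier V \<and>
    (\<forall>x\<in>carrier V. \<exists>l \<in> B \<rightarrow> carrier K. x = (\<Oplus>\<^bsub>V\<^esub>b\<in>B. l b \<odot>\<^bsub>V\<^esub> b)))"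

text \<open>The last conjunct says \<open>A/J = k\<close>, by means of the structure map
  \<open>k \<rightarrow> A \<rightarrow> A/J\<close>.\<close>

definition short_local_algebra :: "('k, 'x) ring_scheme \<Rightarrow> ('k, 'a, 'm) module_scheme \<Rightarrow> bool"
  where "short_local_algebra K A \<longleftrightarrow>
    k_algebra K A \<and> finite_dimensional K A \<and> local_ring A \<and> rad_pow A 3 = {\<zero>\<^bsub>A\<^esub>} \<and>
    (\<lambda>l. radical A +>\<^bsub>A\<^esub> (l \<odot>\<^bsub>A\<^esub> \<one>\<^bsub>A\<^esub>)) \<in> ring_iso K (A Quot (radical A))"

definition hilbert_type :: "('a, 'r) ring_scheme \<Rightarrow> nat \<times> nat \<Rightarrow> bool"
  where "hilbert_type A = (\<lambda>(e, a).
    has_length A (quot_mod ((regular_module A)\<lparr>carrier := radical A\<rparr>) (rad_pow A 2)) e \<and>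
    has_length A ((regular_module A)\<lparr>carrier := rad_pow A 2\<rparr>) a)"

definition loewy_length_at_most :: "('a, 'r) ring_scheme \<Rightarrow> ('a, 'b, 'm) module_scheme \<Rightarrow> nat \<Rightarrow> bool"
  where "loewy_length_at_most A M n \<longleftrightarrow> rad_mod A n M = {\<zero>\<^bsub>M\<^esub>}"

definition dimension_vector :: "('a, 'r) ring_scheme \<Rightarrow> ('a, 'b, 'm) module_scheme \<Rightarrow> nat \<times> nat \<Rightarrow> bool"
  where "dimension_vector A M = (\<lambda>(p, q).
    has_length A (quot_mod M (rad_mod A 1 M)) p \<and>
    has_length A (M\<lparr>carrier := rad_mod A 1 M\<rparr>) q)"

definition free_module :: "('a, 'r) ring_scheme \<Rightarrow> nat \<Rightarrow> ('a, nat \<Rightarrow> 'a) module"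
  where "free_module A n =
    \<lparr>carrier = {..<n} \<rightarrow>\<^sub>E carrier A, mult = undefined, one = undefined,
     zero = (\<lambda>i\<in>{..<n}. \<zero>\<^bsub>A\<^esub>), add = (\<lambda>f g. \<lambda>i\<in>{..<n}. f i \<oplus>\<^bsub>A\<^esub> g i),
     smult = (\<lambda>a f. \<lambda>i\<in>{..<n}. a \<otimes>\<^bsub>A\<^esub> f i)\<rparr>"

text \<open>Direct summands of free modules of finite rank, up to isomorphism; finite rank is the
  right notion because all modules considered are finitely generated.\<close>

definition projective_module :: "('a, 'r) ring_scheme \<Rightarrow> ('a, 'b, 'm) module_scheme \<Rightarrow> bool"
  where "projective_module A P \<longleftrightarrow> left_module A P \<and>
    (\<exists>n U V. submodule U A (free_module A n) \<and> submodule V A (free_module A n) \<and>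
      U <+>\<^bsub>free_module A n\<^esub> V = carrier (free_module A n) \<and>
      U \<inter> V = {\<zero>\<^bsub>free_module A n\<^esub>} \<and>
      (\<exists>f \<in> mod_hom A P ((free_module A n)\<lparr>carrier := U\<rparr>). bij_betw f (carrier P) U))"

definition superfluous :: "('a, 'r) ring_scheme \<Rightarrow> ('a, 'b, 'm) module_scheme \<Rightarrow> 'b set \<Rightarrow> bool"
  where "superfluous A M S \<longleftrightarrow>
    (\<forall>U. submodule U A M \<and> U <+>\<^bsub>M\<^esub> S = carrier M \<longrightarrow> U = carrier M)"

text \<open>Here \<open>\<epsilon> : P\<^sub>0 \<rightarrow> M\<close> and \<open>d i : P\<^sub>i\<^sub>+\<^sub>1 \<rightarrow> P\<^sub>i\<close>.  Minimality means that
  each \<open>P\<^sub>i\<close> is a projective cover of its image in the resolution.\<close>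

definition minimal_projective_resolution ::
    "('a, 'r) ring_scheme \<Rightarrow> ('a, 'b, 'm) module_scheme \<Rightarrow>
     (nat \<Rightarrow> ('a, 'c, 'n) module_scheme) \<Rightarrow> (nat \<Rightarrow> 'c \<Rightarrow> 'c) \<Rightarrow> ('c \<Rightarrow> 'b) \<Rightarrow> bool"
  where "minimal_projective_resolution A M P d \<epsilon> \<longleftrightarrow>
    (\<forall>i. projective_module A (P i)) \<and>
    \<epsilon> \<in> mod_hom A (P 0) M \<and> (\<forall>i. d i \<in> mod_hom A (P (Suc i)) (P i)) \<and>
    \<epsilon> ` carrier (P 0) = carrier M \<and>
    d 0 ` carrier (P 1) = a_kernel (P 0) M \<epsilon> \<and>
    (\<forall>i. d (Suc i) ` carrier (P (Suc (Suc i))) = a_kernel (P (Suc i)) (P i) (d i)) \<and>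
    superfluous A (P 0) (a_kernel (P 0) M \<epsilon>) \<and>
    (\<forall>i. superfluous A (P (Suc i)) (a_kernel (P (Suc i)) (P i) (d i)))"

text \<open>\<open>layer A j M\<close> is \<open>J\<^sup>j M / J\<^sup>j\<^sup>+\<^sup>1 M\<close>.\<close>

definition layer :: "('a, 'r) ring_scheme \<Rightarrow> nat \<Rightarrow> ('a, 'b, 'm) module_scheme \<Rightarrow> ('a, 'b set) module"
  where "layer A j M = quot_mod (M\<lparr>carrier := rad_mod A j M\<rparr>) (rad_mod A (Suc j) M)"

text \<open>Exactness of
  \<open>0 \<rightarrow> layer 0 P\<^sub>n \<rightarrow> layer 1 P\<^sub>n\<^sub>-\<^sub>1 \<rightarrow> \<dots> \<rightarrow> layer n P\<^sub>0 \<rightarrow> layer n M \<rightarrow> 0\<close>.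
  Here \<open>E\<close> and \<open>D i\<close> are the maps induced by \<open>\<epsilon>\<close> and \<open>d i\<close>, and \<open>im i\<close> is the image of the
  map arriving at the term of \<open>P\<^sub>i\<close>; the conjuncts are exactness at \<open>M\<close>, at
  \<open>P\<^sub>0\<close> and at \<open>P\<^sub>i\<^sub>+\<^sub>1\<close>.\<close>

definition layer_sequence_exact ::
    "('a, 'r) ring_scheme \<Rightarrow> ('a, 'b, 'm) module_scheme \<Rightarrow>
     (nat \<Rightarrow> ('a, 'c, 'n) module_scheme) \<Rightarrow> (nat \<Rightarrow> 'c \<Rightarrow> 'c) \<Rightarrow> ('c \<Rightarrow> 'b) \<Rightarrow> nat \<Rightarrow> bool"
  where "layer_sequence_exact A M P d \<epsilon> n \<longleftrightarrow>
    (let L = (\<lambda>i. layer A (n - i) (P i));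
         E = induced_map M (rad_mod A (Suc n) M) \<epsilon>;
         D = (\<lambda>i. induced_map (P i) (rad_mod A (Suc (n - i)) (P i)) (d i));
         im = (\<lambda>i. if i = n then {\<zero>\<^bsub>L n\<^esub>} else D i ` carrier (L (Suc i)))
     in E ` carrier (L 0) = carrier (layer A n M) \<and>
        a_kernel (L 0) (layer A n M) E = im 0 \<and>
        (\<forall>i<n. a_kernel (L (Suc i)) (L i) (D i) = im (Suc i)))"

text \<open>Every finitely generated projective module has an isomorphic copy inside
  some \<^term>\<open>free_module A n\<close>, so requiring the resolution to live on the type
  \<^typ>\<open>nat \<Rightarrow> 'a\<close> is no restriction.  Minimal resolutions are unique up to isomorphism, so it
  does not matter which one is used.\<close>

definition koszul_module :: "('a, 'r) ring_scheme \<Rightarrow> ('a, 'b, 'm) module_scheme \<Rightarrow> bool"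
  where "koszul_module A M \<longleftrightarrow> left_module A M \<and> (\<exists>l. has_length A M l) \<and>
    (\<exists>(P :: nat \<Rightarrow> ('a, nat \<Rightarrow> 'a) module) d \<epsilon>.
      minimal_projective_resolution A M P d \<epsilon> \<and> (\<forall>n. layer_sequence_exact A M P d \<epsilon> n))"

end

theory Submission
  imports Defs "HOL-Library.Nat_Bijection"
begin

text \<open>Take \<open>A = K[x\<^sub>1, \<dots>, x\<^sub>c]/(x)\<^sup>2 \<otimes> K[y\<^sub>1, \<dots>, y\<^sub>d]/(y)\<^sup>2\<close> and \<open>M = A/(y\<^sub>1, \<dots>, y\<^sub>d)\<close>.
  Each \<open>A y\<^sub>j\<close> is isomorphic to \<open>M\<close>, and the first syzygy of \<open>M\<close> is the direct sum of the
  \<open>A y\<^sub>j\<close>, that is \<open>M\<^sup>d\<close>.  Hence the minimal resolution has \<open>P\<^sub>n\<close> free of rank \<open>d\<^sup>n\<close> with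
  differentials that are homogeneous of degree one for the grading of \<open>A\<close>, so it splits
  into its graded strands, which are the layer sequences.\<close>

section \<open>Left modules, quotients and composition series\<close>

text \<open>The algebra is free over B = K[x_1, ..., x_c]/(x)^2 with basis 1, y_1, ..., y_d, and the
  annihilator of each y_j is (y_1, ..., y_d). This is why A y_j is a copy of the module and why the
  syzygy splits. Every ideal that occurs (J^m, the module, its radical layers) is spanned by
  monomials x_i y_j. Ideals thus become index sets, radical powers become degree bounds, and lengths
  become cardinalities. The obstacle is that Koszulity speaks of quotients J^m P / J^(m+1) P and not
  of graded pieces, so exactness must be checked on cosets. It amounts to this: if x lies in J^m P
  and its differential lies in J^(m+2), then modulo J^(m+1) P the element x is a boundary of
  something in J^(m-1), and it is zero there if m = 0. Such an x is split into a part free of y and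
  a part in (y_1, ..., y_d) P; the second part is divided by the y_j, which lowers the degree by
  one. Taking the ideal A y_1 as the module keeps its elements in the type of the algebra, so one
  coordinate calculus serves both.\<close>

lemma (in left_module) smult_zero_left [simp]:
  assumes "x \<in> carrier M"
  shows "\<zero>\<^bsub>R\<^esub> \<odot>\<^bsub>M\<^esub> x = \<zero>\<^bsub>M\<^esub>"
proof -
  have "\<zero>\<^bsub>R\<^esub> \<odot>\<^bsub>M\<^esub> x \<oplus>\<^bsub>M\<^esub> \<zero>\<^bsub>R\<^esub> \<odot>\<^bsub>M\<^esub> x = \<zero>\<^bsub>R\<^esub> \<odot>\<^bsub>M\<^esub> x"
    using assms smult_l_distr[of "\<zero>\<^bsub>R\<^esub>" "\<zero>\<^bsub>R\<^esub>" x] by simp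
  then show ?thesis
    using assms by (metis M.add.r_cancel_one' R.zero_closed smult_closed)
qed

lemma (in left_module) smult_minus_one:
  assumes "x \<in> carrier M"
  shows "(\<ominus>\<^bsub>R\<^esub> \<one>\<^bsub>R\<^esub>) \<odot>\<^bsub>M\<^esub> x = \<ominus>\<^bsub>M\<^esub> x"
proof -
  have "(\<ominus>\<^bsub>R\<^esub> \<one>\<^bsub>R\<^esub>) \<odot>\<^bsub>M\<^esub> x \<oplus>\<^bsub>M\<^esub> x = \<zero>\<^bsub>M\<^esub>"
    using assms smult_l_distr[of "\<ominus>\<^bsub>R\<^esub> \<one>\<^bsub>R\<^esub>" "\<one>\<^bsub>R\<^esub>" x] by (simp add: R.l_neg)
  then show ?thesis
    using assms by (metis M.minus_equality R.a_inv_closed R.one_closed smult_closed)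
qed

text \<open>Negatives come for free, as multiples by minus one; all later submodule proofs therefore
  need only sums, scalars and zero.\<close>

lemma (in left_module) submodule_iff:
  "submodule U R M \<longleftrightarrow> U \<subseteq> carrier M \<and> \<zero>\<^bsub>M\<^esub> \<in> U \<and>
    (\<forall>x\<in>U. \<forall>y\<in>U. x \<oplus>\<^bsub>M\<^esub> y \<in> U) \<and> (\<forall>a\<in>carrier R. \<forall>x\<in>U. a \<odot>\<^bsub>M\<^esub> x \<in> U)"
    (is "_ \<longleftrightarrow> ?R")
proof
  assume "submodule U R M"
  then interpret U: submodule U R M .
  show ?R
    using U.subset U.one_closed U.m_closed U.smult_closed by auto
next
  assume R: ?R
  have "\<ominus>\<^bsub>M\<^esub> x \<in> U" if "x \<in> U" for x
    using R that smult_minus_one[of x] by (metis R.a_inv_closed R.one_closed subsetD)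
  with R show "submodule U R M"
    by (intro submodule.intro subgroup.intro submodule_axioms.intro)
      (auto simp: a_inv_def[symmetric])
qed

lemma (in left_module) submoduleD:
  assumes "submodule U R M"
  shows "U \<subseteq> carrier M" "\<zero>\<^bsub>M\<^esub> \<in> U" "\<And>x y. x \<in> U \<Longrightarrow> y \<in> U \<Longrightarrow> x \<oplus>\<^bsub>M\<^esub> y \<in> U"
    "\<And>a x. a \<in> carrier R \<Longrightarrow> x \<in> U \<Longrightarrow> a \<odot>\<^bsub>M\<^esub> x \<in> U"
  using assms by (simp_all add: submodule_iff)

lemma (in left_module) submodule_left_module:
  assumes "submodule N R M"
  shows "left_module R (M\<lparr>carrier := N\<rparr>)"
proof -
  interpret N: submodule N R M by fact
  have "group ((add_monoid M)\<lparr>carrier := N\<rparr>)"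
    by (rule M.add.subgroup_imp_group[OF N.subgroup_axioms])
  then have "comm_group ((add_monoid M)\<lparr>carrier := N\<rparr>)"
    using N.subset by (intro group.group_comm_groupI) (auto intro!: M.a_comm)
  then have "abelian_group (M\<lparr>carrier := N\<rparr>)"
    by (intro abelian_group.intro abelian_monoid.intro abelian_group_axioms.intro)
      (simp_all add: comm_group_def)
  moreover have "x \<in> carrier M" if "x \<in> N" for x
    using N.subset that by auto
  ultimately show ?thesis
    by (intro left_module.intro left_module_axioms.intro R.ring_axioms)
      (simp_all add: smult_l_distr smult_r_distr smult_assoc)
qed

lemma (in left_module) submodule_restrict_iff:
  assumes "submodule N R M"
  shows "submodule U R (M\<lparr>carrier := N\<rparr>) \<longleftrightarrow> submodule U R M \<and> U \<subseteq> N"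
  using submodule_iff[of U] left_module.submodule_iff[OF submodule_left_module[OF assms], of U]
    submodule_iff[of N] assms by auto

lemma (in left_module) abelian_subgroup_submodule:
  assumes "submodule N R M"
  shows "abelian_subgroup N M"
  using assms by (intro abelian_subgroupI3 additive_subgroup.intro submodule.axioms(1) M.abelian_group_axioms)

text \<open>Scaling a coset gives only \<open>a N + a x\<close>, which may be smaller than a coset;
  the summand \<open>N\<close> in \<open>quot_mod\<close> fills it up. Representatives can then be
  used for scalar multiplication.\<close>

lemma (in left_module) smult_coset:
  assumes "submodule N R M" "a \<in> carrier R" "x \<in> carrier M"
  shows "N <+>\<^bsub>M\<^esub> ((\<lambda>y. a \<odot>\<^bsub>M\<^esub> y) ` (N +>\<^bsub>M\<^esub> x)) = N +>\<^bsub>M\<^esub> (a \<odot>\<^bsub>M\<^esub> x)"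
proof -
  note N = submoduleD[OF assms(1)]
  show ?thesis
  proof (intro equalityI subsetI)
    fix z assume "z \<in> N <+>\<^bsub>M\<^esub> ((\<lambda>y. a \<odot>\<^bsub>M\<^esub> y) ` (N +>\<^bsub>M\<^esub> x))"
    then obtain h n where hn: "h \<in> N" "n \<in> N" "z = h \<oplus>\<^bsub>M\<^esub> a \<odot>\<^bsub>M\<^esub> (n \<oplus>\<^bsub>M\<^esub> x)"
      by (auto simp: set_add_def' a_r_coset_def')
    then have "z = (h \<oplus>\<^bsub>M\<^esub> a \<odot>\<^bsub>M\<^esub> n) \<oplus>\<^bsub>M\<^esub> a \<odot>\<^bsub>M\<^esub> x"
      using N(1) assms by (simp add: smult_r_distr subsetD M.a_assoc)
    then show "z \<in> N +>\<^bsub>M\<^esub> (a \<odot>\<^bsub>M\<^esub> x)"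
      using hn N(3,4) assms(2) by (auto simp: a_r_coset_def' intro!: bexI[of _ "h \<oplus>\<^bsub>M\<^esub> a \<odot>\<^bsub>M\<^esub> n"])
  next
    fix z assume "z \<in> N +>\<^bsub>M\<^esub> (a \<odot>\<^bsub>M\<^esub> x)"
    then obtain h where h: "h \<in> N" "z = h \<oplus>\<^bsub>M\<^esub> a \<odot>\<^bsub>M\<^esub> (\<zero>\<^bsub>M\<^esub> \<oplus>\<^bsub>M\<^esub> x)"
      using assms by (auto simp: a_r_coset_def')
    then show "z \<in> N <+>\<^bsub>M\<^esub> ((\<lambda>y. a \<odot>\<^bsub>M\<^esub> y) ` (N +>\<^bsub>M\<^esub> x))"
      using N by (force simp: set_add_def' a_r_coset_def')
  qed
qed

text \<open>The additive group is that of \<open>M A_Mod N\<close>, so its axioms are inherited; the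
  scalar axioms pass to representatives.\<close>

lemma (in left_module) quot_mod_left_module:
  assumes "submodule N R M"
  shows "left_module R (quot_mod M N)"
proof -
  interpret N: abelian_subgroup N M
    by (rule abelian_subgroup_submodule[OF assms])
  interpret Q: comm_group "M A_Mod N"
    by (rule N.a_factorgroup_is_comm_group)
  have Q: "carrier (quot_mod M N) = carrier (M A_Mod N)" "add (quot_mod M N) = mult (M A_Mod N)"
    "\<zero>\<^bsub>quot_mod M N\<^esub> = \<one>\<^bsub>M A_Mod N\<^esub>"
    by (simp_all add: quot_mod_def A_FactGroup_def FactGroup_def A_RCOSETS_def set_add_def)
  have ab: "abelian_group (quot_mod M N)"
    by (rule abelian_groupI) (simp_all only: Q Q.m_closed Q.one_closed Q.m_ac Q.l_one Q.r_one Q.l_inv_ex)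
  have carr: "\<exists>x\<in>carrier M. X = N +>\<^bsub>M\<^esub> x" if "X \<in> carrier (quot_mod M N)" for X
    using that by (auto simp: quot_mod_def A_RCOSETS_def')
  have carr': "N +>\<^bsub>M\<^esub> x \<in> carrier (quot_mod M N)" if "x \<in> carrier M" for x
    using that by (auto simp: quot_mod_def A_RCOSETS_def')
  have add: "(N +>\<^bsub>M\<^esub> x) \<oplus>\<^bsub>quot_mod M N\<^esub> (N +>\<^bsub>M\<^esub> y) = N +>\<^bsub>M\<^esub> (x \<oplus>\<^bsub>M\<^esub> y)"
    if "x \<in> carrier M" "y \<in> carrier M" for x y
    using that by (simp add: quot_mod_def N.a_rcos_sum)
  have smult: "a \<odot>\<^bsub>quot_mod M N\<^esub> (N +>\<^bsub>M\<^esub> x) = N +>\<^bsub>M\<^esub> (a \<odot>\<^bsub>M\<^esub> x)"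
    if "a \<in> carrier R" "x \<in> carrier M" for a x
    using smult_coset[OF assms that] by (simp add: quot_mod_def)
  show ?thesis
    using R.ring_axioms ab
    by (intro left_module.intro left_module_axioms.intro)
      (auto dest!: carr simp: add smult carr' smult_l_distr smult_r_distr smult_assoc)
qed

section \<open>Composition series between two submodules\<close>

text \<open>Allowing arbitrary end points makes series composable, and the same series then measures
  a submodule or a quotient.\<close>

definition submodule_chain ::
    "('a, 'r) ring_scheme \<Rightarrow> ('a, 'b, 'm) module_scheme \<Rightarrow> 'b set \<Rightarrow> 'b set \<Rightarrow> nat \<Rightarrow> bool"
  where "submodule_chain A M N0 N1 n \<longleftrightarrow> (\<exists>s :: nat \<Rightarrow> 'b set.
    s 0 = N0 \<and> s n = N1 \<and> (\<forall>i\<le>n. submodule (s i) A M) \<and>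
    (\<forall>i<n. s i \<subset> s (Suc i) \<and> \<not> (\<exists>U. submodule U A M \<and> s i \<subset> U \<and> U \<subset> s (Suc i))))"

lemma submodule_chainE:
  assumes "submodule_chain A M N0 N1 n"
  obtains s where "s 0 = N0" "s n = N1" "\<forall>i\<le>n. submodule (s i) A M" "\<forall>i<n. s i \<subset> s (Suc i)"
    "\<forall>i<n. \<forall>U. submodule U A M \<longrightarrow> s i \<subset> U \<longrightarrow> \<not> U \<subset> s (Suc i)"
proof -
  obtain s where s: "s 0 = N0" "s n = N1" "\<forall>i\<le>n. submodule (s i) A M"
    "\<forall>i<n. s i \<subset> s (Suc i) \<and> \<not> (\<exists>U. submodule U A M \<and> s i \<subset> U \<and> U \<subset> s (Suc i))"
    using assms unfolding submodule_chain_def by (elim exE conjE)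
  then show ?thesis
    by (intro that[of s]) simp_all
qed

lemma submodule_chainI:
  assumes "s 0 = N0" "s n = N1" "\<And>i. i \<le> n \<Longrightarrow> submodule (s i) A M"
    "\<And>i. i < n \<Longrightarrow> s i \<subset> s (Suc i)"
    "\<And>i U. \<lbrakk>i < n; submodule U A M; s i \<subset> U; U \<subset> s (Suc i)\<rbrakk> \<Longrightarrow> False"
  shows "submodule_chain A M N0 N1 n"
  unfolding submodule_chain_def using assms
  by (intro exI[of _ s] conjI allI impI notI) (assumption | elim exE conjE | rule assms)+

lemma has_length_iff_chain: "has_length A M n \<longleftrightarrow> submodule_chain A M {\<zero>\<^bsub>M\<^esub>} (carrier M) n"
  by (simp add: has_length_def submodule_chain_def)

lemma submodule_chain_append:
  assumes "submodule_chain A M N0 N1 m" "submodule_chain A M N1 N2 n"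
  shows "submodule_chain A M N0 N2 (m + n)"
proof -
  obtain s where s: "s 0 = N0" "s m = N1" "\<forall>i\<le>m. submodule (s i) A M" "\<forall>i<m. s i \<subset> s (Suc i)"
    "\<forall>i<m. \<forall>U. submodule U A M \<longrightarrow> s i \<subset> U \<longrightarrow> \<not> U \<subset> s (Suc i)"
    by (rule submodule_chainE[OF assms(1)])
  obtain t where t: "t 0 = N1" "t n = N2" "\<forall>i\<le>n. submodule (t i) A M" "\<forall>i<n. t i \<subset> t (Suc i)"
    "\<forall>i<n. \<forall>U. submodule U A M \<longrightarrow> t i \<subset> U \<longrightarrow> \<not> U \<subset> t (Suc i)"
    by (rule submodule_chainE[OF assms(2)])
  define u where "u i = (if i \<le> m then s i else t (i - m))" for i
  have u1: "u i = s i" "u (Suc i) = s (Suc i)" if "i < m" for i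
    using that by (simp_all add: u_def)
  \<comment> \<open>For \<open>i = m\<close> the two pieces agree because \<open>s m\<close> and
    \<open>t 0\<close> are both \<open>N1\<close>.\<close>
  have u2: "u i = t (i - m)" "u (Suc i) = t (Suc (i - m))" "i - m < n" if "\<not> i < m" "i < m + n" for i
    using that s(2) t(1) by (auto simp: u_def Suc_diff_le)
  show ?thesis
  proof (rule submodule_chainI[of u])
    show "u 0 = N0" "u (m + n) = N2"
      using s(1,2) t(1,2) by (auto simp: u_def)
    show "submodule (u i) A M" if "i \<le> m + n" for i
      using that s(3) t(3) by (auto simp: u_def)
    show "u i \<subset> u (Suc i)" if "i < m + n" for i
      using that s(4) t(4) by (cases "i < m") (simp_all add: u1 u2)
    show False if "i < m + n" "submodule U A M" "u i \<subset> U" "U \<subset> u (Suc i)" for i U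
      using that s(5) t(5) by (cases "i < m") (simp_all add: u1 u2)
  qed
qed

lemma (in left_module) submodule_chain_restrict:
  assumes X: "submodule X R M" and chain: "submodule_chain R M N0 X n"
  shows "submodule_chain R (M\<lparr>carrier := X\<rparr>) N0 X n"
proof -
  obtain s where s: "s 0 = N0" "s n = X" "\<forall>i\<le>n. submodule (s i) R M" "\<forall>i<n. s i \<subset> s (Suc i)"
    "\<forall>i<n. \<forall>U. submodule U R M \<longrightarrow> s i \<subset> U \<longrightarrow> \<not> U \<subset> s (Suc i)"
    by (rule submodule_chainE[OF chain])
  have sub: "s i \<subseteq> X" if "i \<le> n" for i
    using that
  proof (induction rule: inc_induct)
    case base
    then show ?case using s(2) by simp
  next
    case (step i)
    then show ?case using s(4) by auto
  qed
  show ?thesis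
  proof (rule submodule_chainI[of s])
    show "submodule (s i) R (M\<lparr>carrier := X\<rparr>)" if "i \<le> n" for i
      using that s(3) sub submodule_restrict_iff[OF X] by simp
    show False if "i < n" "submodule U R (M\<lparr>carrier := X\<rparr>)" "s i \<subset> U" "U \<subset> s (Suc i)" for i U
      using that s(5) submodule_restrict_iff[OF X] by simp
  qed (use s in simp_all)
qed

text \<open>Submodules of the quotient correspond to submodules containing \<open>N\<close>: images
  of the series are again strictly increasing, and a submodule squeezed between two images would
  have its preimage squeezed between two members.\<close>

lemma (in left_module) has_length_quot_mod:
  assumes chain: "submodule_chain R M N (carrier M) n"
  shows "has_length R (quot_mod M N) n"
proof -
  obtain s where s: "s 0 = N" "s n = carrier M" "\<forall>i\<le>n. submodule (s i) R M" "\<forall>i<n. s i \<subset> s (Suc i)"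
    "\<forall>i<n. \<forall>U. submodule U R M \<longrightarrow> s i \<subset> U \<longrightarrow> \<not> U \<subset> s (Suc i)"
    by (rule submodule_chainE[OF chain])
  have N: "submodule N R M"
    using s(1,3) by auto
  have Ns: "N \<subseteq> s i" if "i \<le> n" for i
    using that s(1,4) by (induction i) (auto simp: Suc_le_eq less_imp_le)
  interpret N: abelian_subgroup N M
    by (rule abelian_subgroup_submodule[OF N])
  interpret Q: left_module R "quot_mod M N"
    by (rule quot_mod_left_module[OF N])
  let ?q = "\<lambda>x. N +>\<^bsub>M\<^esub> x"
  have carr: "carrier (quot_mod M N) = ?q ` carrier M"
    by (auto simp: quot_mod_def A_RCOSETS_def')
  have add: "?q x \<oplus>\<^bsub>quot_mod M N\<^esub> ?q y = ?q (x \<oplus>\<^bsub>M\<^esub> y)"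
    if "x \<in> carrier M" "y \<in> carrier M" for x y
    using that by (simp add: quot_mod_def N.a_rcos_sum)
  have smult: "a \<odot>\<^bsub>quot_mod M N\<^esub> ?q x = ?q (a \<odot>\<^bsub>M\<^esub> x)"
    if "a \<in> carrier R" "x \<in> carrier M" for a x
    using smult_coset[OF N that] by (simp add: quot_mod_def)
  have zero: "\<zero>\<^bsub>quot_mod M N\<^esub> = ?q \<zero>\<^bsub>M\<^esub>" "\<zero>\<^bsub>quot_mod M N\<^esub> = N"
    by (simp_all add: quot_mod_def N.a_rcos_const[OF N.zero_closed])
  have sC: "s i \<subseteq> carrier M" if "i \<le> n" for i
    using s(3) that by (intro submoduleD(1)) simp
  have image: "submodule (?q ` S) R (quot_mod M N)" if "submodule S R M" for S
  proof -
    note S = submoduleD[OF that]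
    show ?thesis
      unfolding Q.submodule_iff using S
      by (auto simp: carr zero(1) add smult subsetD)
  qed
  have preimage: "submodule {x \<in> carrier M. ?q x \<in> U} R M" if "submodule U R (quot_mod M N)" for U
    using that unfolding Q.submodule_iff submodule_iff zero(1)
    by (auto simp: add[symmetric] smult[symmetric])
  \<comment> \<open>A submodule containing \<open>N\<close> is a union of cosets of
    \<open>N\<close>, so membership can be read off in the quotient.\<close>
  have mem: "x \<in> S" if S0: "submodule S R M" "N \<subseteq> S" "?q x \<in> ?q ` S" "x \<in> carrier M" for S x
  proof -
    note S = submoduleD[OF S0(1)]
    obtain y where y: "y \<in> S" "?q x = ?q y" using S0(3) by blast
    have "x \<in> ?q x" using S0(4) N.a_rcos_self by blast
    then obtain h where "h \<in> N" "x = h \<oplus>\<^bsub>M\<^esub> y"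
      unfolding y(2) by (auto simp: a_r_coset_def')
    then show ?thesis using y(1) S(3) S0(2) by auto
  qed
  show ?thesis
    unfolding has_length_iff_chain
  proof (rule submodule_chainI[of "\<lambda>i. ?q ` s i"])
    fix i assume i: "i < n"
    obtain x where x: "x \<in> s (Suc i)" "x \<notin> s i" using s(4) i by blast
    then have "x \<in> carrier M" using sC[of "Suc i"] i by auto
    then have "?q x \<notin> ?q ` s i"
      using mem[OF _ Ns, of i x] s(3) x i by auto
    then show "?q ` s i \<subset> ?q ` s (Suc i)"
      using s(4) i x by blast
  next
    fix i U
    assume i: "i < n" and U: "submodule U R (quot_mod M N)" "?q ` s i \<subset> U" "U \<subset> ?q ` s (Suc i)"
    let ?U = "{x \<in> carrier M. ?q x \<in> U}"
    have "s i \<subseteq> ?U" using U(2) sC[of i] i by auto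
    moreover obtain X where X: "X \<in> U" "X \<notin> ?q ` s i"
      using U(2) by blast
    moreover obtain x where "x \<in> carrier M" "X = ?q x"
      using X(1) Q.submoduleD(1)[OF U(1)] carr by blast
    ultimately have "s i \<subset> ?U" by auto
    moreover have "?U \<subset> s (Suc i)"
    proof (rule psubsetI)
      show "?U \<subseteq> s (Suc i)"
      proof
        fix x assume "x \<in> ?U"
        then have "?q x \<in> ?q ` s (Suc i)" "x \<in> carrier M" using U(3) by blast+
        then show "x \<in> s (Suc i)"
          using i s(3) Ns[of "Suc i"] by (intro mem[of "s (Suc i)"]) simp_all
      qed
      show "?U \<noteq> s (Suc i)" using U(3) by blast
    qed
    ultimately show False
      using s(5) i preimage[OF U(1)] by simp
  next
    show "?q ` s 0 = {\<zero>\<^bsub>quot_mod M N\<^esub>}"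
    proof -
      have "?q ` N = (\<lambda>_. N) ` N"
        by (rule image_cong) (simp_all add: N.a_rcos_const)
      then show ?thesis
        using N.zero_closed by (simp add: s(1) zero(2) image_constant[of "\<zero>\<^bsub>M\<^esub>"])
    qed
    show "?q ` s n = carrier (quot_mod M N)"
      by (simp add: s(2) carr)
    show "submodule (?q ` s i) R (quot_mod M N)" if "i \<le> n" for i
      using that image s(3) by simp
  qed
qed

section \<open>Regular and free modules\<close>

lemma ring_regular_module:
  assumes "ring A"
  shows "left_module A (regular_module A)"
proof -
  interpret ring A by fact
  have "abelian_group (regular_module A)"
    by (rule abelian_groupI) (auto simp: regular_module_def a_ac intro: l_neg)
  then show ?thesis
    by (intro left_module.intro left_module_axioms.intro ring_axioms)
      (auto simp: regular_module_def l_distr r_distr m_assoc)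
qed

lemma free_module_left_module:
  assumes "ring A"
  shows "left_module A (free_module A n)"
proof -
  interpret ring A by fact
  have "abelian_group (free_module A n)"
  proof (rule abelian_groupI)
    fix x assume "x \<in> carrier (free_module A n)"
    then show "\<exists>y\<in>carrier (free_module A n). y \<oplus>\<^bsub>free_module A n\<^esub> x = \<zero>\<^bsub>free_module A n\<^esub>"
      by (intro bexI[of _ "\<lambda>i\<in>{..<n}. \<ominus>\<^bsub>A\<^esub> x i"])
        (auto simp: free_module_def PiE_iff l_neg intro!: restrict_ext)
  qed (auto simp: free_module_def PiE_iff a_ac extensional_def fun_eq_iff)
  then show ?thesis
    by (intro left_module.intro left_module_axioms.intro ring_axioms)
      (auto simp: free_module_def PiE_iff l_distr r_distr m_assoc extensional_def fun_eq_iff)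
qed

lemma free_module_projective:
  assumes "ring A"
  shows "projective_module A (free_module A n)"
proof -
  let ?F = "free_module A n"
  interpret F: left_module A ?F
    by (rule free_module_left_module[OF assms])
  have "?F\<lparr>carrier := carrier ?F\<rparr> = ?F" by simp
  then have "id \<in> mod_hom A ?F (?F\<lparr>carrier := carrier ?F\<rparr>)"
    by (simp add: mod_hom_def)
  moreover have "submodule (carrier ?F) A ?F" "submodule {\<zero>\<^bsub>?F\<^esub>} A ?F"
    unfolding F.submodule_iff using assms
    by (auto simp: free_module_def ring.ring_simprules intro!: restrict_ext)
  moreover have "carrier ?F <+>\<^bsub>?F\<^esub> {\<zero>\<^bsub>?F\<^esub>} = carrier ?F"
    by (force simp: set_add_def')
  moreover have "carrier ?F \<inter> {\<zero>\<^bsub>?F\<^esub>} = {\<zero>\<^bsub>?F\<^esub>}"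
    by auto
  ultimately show ?thesis
    unfolding projective_module_def using F.left_module_axioms
    by (intro conjI exI[of _ n] exI[of _ "carrier ?F"] exI[of _ "{\<zero>\<^bsub>?F\<^esub>}"] bexI[of _ id]) simp_all
qed

text \<open>An element with entries in \<open>I\<close> is the sum of its entries times the basis
  vectors. Zero is not generated by a rule of \<open>ideal_smult\<close> and is produced as a zero
  multiple.\<close>

lemma ideal_smult_free_module:
  assumes "ring A" and I: "ideal I A"
  shows "ideal_smult I (free_module A n) = {f \<in> carrier (free_module A n). \<forall>i<n. f i \<in> I}"
    (is "?L = ?R")
proof (intro equalityI subsetI)
  interpret ring A by fact
  interpret I: ideal I A by fact
  fix f assume "f \<in> ?L"
  then show "f \<in> ?R"
    by induction (auto simp: free_module_def PiE_iff extensional_def I.I_r_closed)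
next
  interpret ring A by fact
  interpret I: ideal I A by fact
  fix f assume f: "f \<in> ?R"
  \<comment> \<open>\<open>t k\<close> keeps the first \<open>k\<close> entries of \<open>f\<close>;
    each step adds \<open>f k\<close> times the basis vector \<open>?e\<close>.\<close>
  define t where "t k = (\<lambda>i\<in>{..<n}. if i < k then f i else \<zero>\<^bsub>A\<^esub>)" for k
  have "t k \<in> ?L" for k
  proof (induction k)
    case 0
    have "\<zero>\<^bsub>A\<^esub> \<odot>\<^bsub>free_module A n\<^esub> (\<lambda>i\<in>{..<n}. \<one>\<^bsub>A\<^esub>) \<in> ?L"
      by (intro ideal_smult.smult) (auto simp: free_module_def)
    moreover have "\<zero>\<^bsub>A\<^esub> \<odot>\<^bsub>free_module A n\<^esub> (\<lambda>i\<in>{..<n}. \<one>\<^bsub>A\<^esub>) = t 0"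
      by (auto simp: t_def free_module_def intro!: restrict_ext)
    ultimately show ?case by simp
  next
    case (Suc k)
    show ?case
    proof (cases "k < n")
      case True
      let ?e = "\<lambda>i\<in>{..<n}. if i = k then \<one>\<^bsub>A\<^esub> else \<zero>\<^bsub>A\<^esub>"
      have "t k \<oplus>\<^bsub>free_module A n\<^esub> f k \<odot>\<^bsub>free_module A n\<^esub> ?e \<in> ?L"
        using f True by (intro ideal_smult.sum Suc.IH ideal_smult.smult) (auto simp: free_module_def)
      moreover have "t k \<oplus>\<^bsub>free_module A n\<^esub> f k \<odot>\<^bsub>free_module A n\<^esub> ?e = t (Suc k)"
        using f True by (auto simp: t_def free_module_def PiE_iff less_Suc_eq intro!: restrict_ext)
      ultimately show ?thesis by simp
    next
      case False
      then have "t (Suc k) = t k" by (auto simp: t_def)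
      with Suc show ?thesis by simp
    qed
  qed
  moreover have "t n = f"
    using f by (auto simp: t_def free_module_def fun_eq_iff PiE_iff extensional_def)
  ultimately show "f \<in> ?L" by metis
qed

section \<open>Cosets and maps between quotients\<close>

lemma (in left_module) coset_eqI:
  assumes "submodule U R M" "s \<in> U" "y \<in> carrier M"
  shows "U +>\<^bsub>M\<^esub> (s \<oplus>\<^bsub>M\<^esub> y) = U +>\<^bsub>M\<^esub> y"
proof -
  interpret U: abelian_subgroup U M
    by (rule abelian_subgroup_submodule[OF assms(1)])
  have "s \<oplus>\<^bsub>M\<^esub> y \<in> U +>\<^bsub>M\<^esub> y"
    using assms(2) by (auto simp: a_r_coset_def')
  then show ?thesis
    using U.a_repr_independence' assms(3) by simp
qed

lemma (in left_module) coset_eq_self_iff: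
  assumes "submodule U R M" "y \<in> carrier M"
  shows "U +>\<^bsub>M\<^esub> y = U \<longleftrightarrow> y \<in> U"
proof -
  interpret U: abelian_subgroup U M
    by (rule abelian_subgroup_submodule[OF assms(1)])
  show ?thesis
    using U.a_rcos_self[OF assms(2)] U.a_rcos_const by auto
qed

lemma carrier_quot_mod_restrict:
  "carrier (quot_mod (M\<lparr>carrier := X\<rparr>) U) = (\<lambda>x. U +>\<^bsub>M\<^esub> x) ` X"
  by (auto simp: quot_mod_def A_RCOSETS_def' a_r_coset_def')

lemma zero_quot_mod: "\<zero>\<^bsub>quot_mod M U\<^esub> = U"
  by (simp add: quot_mod_def)

lemma (in left_module) induced_map_coset:
  assumes f: "f \<in> mod_hom R X M" and V: "submodule V R M" and U: "submodule U R X" "left_module R X"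
    and UV: "f ` U \<subseteq> V" and x: "x \<in> carrier X"
  shows "induced_map M V f (U +>\<^bsub>X\<^esub> x) = V +>\<^bsub>M\<^esub> f x"
proof -
  note V = submoduleD[OF V] and U = left_module.submoduleD[OF U(2,1)]
  have fx: "f x \<in> carrier M" using f x by (auto simp: mod_hom_def)
  have fu: "f (u \<oplus>\<^bsub>X\<^esub> x) = f u \<oplus>\<^bsub>M\<^esub> f x" "f u \<in> V" if "u \<in> U" for u
  proof -
    have "u \<in> carrier X" using U(1) that by blast
    then show "f (u \<oplus>\<^bsub>X\<^esub> x) = f u \<oplus>\<^bsub>M\<^esub> f x" using f x by (simp add: mod_hom_def)
    show "f u \<in> V" using UV that by blast
  qed
  show ?thesis
    unfolding induced_map_def
  proof (intro equalityI subsetI)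
    fix z assume "z \<in> V <+>\<^bsub>M\<^esub> (f ` (U +>\<^bsub>X\<^esub> x))"
    then obtain v u where vu: "v \<in> V" "u \<in> U" "z = v \<oplus>\<^bsub>M\<^esub> f (u \<oplus>\<^bsub>X\<^esub> x)"
      by (auto simp: set_add_def' a_r_coset_def')
    then have "v \<in> carrier M" "f u \<in> carrier M" using V(1) fu(2) by blast+
    then have "z = (v \<oplus>\<^bsub>M\<^esub> f u) \<oplus>\<^bsub>M\<^esub> f x"
      using vu fu(1) fx by (simp add: M.a_assoc)
    then show "z \<in> V +>\<^bsub>M\<^esub> f x"
      using V(3)[OF vu(1) fu(2)[OF vu(2)]] by (auto simp: a_r_coset_def')
  next
    fix z assume "z \<in> V +>\<^bsub>M\<^esub> f x"
    then obtain v where v: "v \<in> V" "z = v \<oplus>\<^bsub>M\<^esub> f x"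
      by (auto simp: a_r_coset_def')
    have "\<zero>\<^bsub>X\<^esub> \<oplus>\<^bsub>X\<^esub> x = x"
      using x assms(4) by (simp add: left_module_def abelian_group_def abelian_monoid.l_zero)
    then have "x \<in> U +>\<^bsub>X\<^esub> x"
      using U(2) by (force simp: a_r_coset_def')
    then show "z \<in> V <+>\<^bsub>M\<^esub> (f ` (U +>\<^bsub>X\<^esub> x))"
      using v by (auto simp: set_add_def')
  qed
qed

lemma (in left_module) induced_map_image:
  assumes f: "f \<in> mod_hom R X M" and V: "submodule V R M" and U: "submodule U R X" "left_module R X"
    and UV: "f ` U \<subseteq> V" and X1: "X1 \<subseteq> carrier X"
  shows "induced_map M V f ` carrier (quot_mod (X\<lparr>carrier := X1\<rparr>) U) = (\<lambda>x. V +>\<^bsub>M\<^esub> f x) ` X1"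
  unfolding carrier_quot_mod_restrict image_image
  using X1 by (intro image_cong refl induced_map_coset[OF f V U UV]) blast

text \<open>The zero of the target is the coset \<open>V\<close>, so a class dies exactly when
  \<open>f\<close> sends a representative into \<open>V\<close>. Together with
  \<open>induced_map_image\<close> this turns exactness into an equality of two families of
  cosets.\<close>

lemma (in left_module) induced_map_kernel:
  assumes f: "f \<in> mod_hom R X M" and V: "submodule V R M" and U: "submodule U R X" "left_module R X"
    and UV: "f ` U \<subseteq> V" and X1: "X1 \<subseteq> carrier X"
  shows "a_kernel (quot_mod (X\<lparr>carrier := X1\<rparr>) U) (quot_mod (M\<lparr>carrier := M1\<rparr>) V) (induced_map M V f) =
    (\<lambda>x. U +>\<^bsub>X\<^esub> x) ` {x \<in> X1. f x \<in> V}"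
proof -
  have "induced_map M V f (U +>\<^bsub>X\<^esub> x) = V \<longleftrightarrow> f x \<in> V" if "x \<in> X1" for x
  proof -
    have x: "x \<in> carrier X" using that X1 by blast
    then have "f x \<in> carrier M" using f by (auto simp: mod_hom_def)
    then show ?thesis
      using induced_map_coset[OF f V U UV x] coset_eq_self_iff[OF V] by simp
  qed
  then show ?thesis
    by (auto simp: a_kernel_def kernel_def carrier_quot_mod_restrict zero_quot_mod)
qed

lemma (in abelian_group) add_eq_minus_iff:
  assumes "x \<in> carrier G" "y \<in> carrier G"
  shows "x = y \<oplus> (x \<ominus> y)"
  using assms by (simp add: minus_eq a_lcomm r_neg)

section \<open>The algebra\<close>

text \<open>A doubly indexed family is stored as a function on \<^typ>\<open>nat\<close> by pairing the indices.\<close>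

definition coord :: "(nat \<Rightarrow> 'k) \<Rightarrow> nat \<Rightarrow> nat \<Rightarrow> 'k"
  where "coord f i j = f (prod_encode (i, j))"

definition of_coords :: "(nat \<Rightarrow> nat \<Rightarrow> 'k) \<Rightarrow> nat \<Rightarrow> 'k"
  where "of_coords F n = (case prod_decode n of (i, j) \<Rightarrow> F i j)"

lemma coord_of_coords [simp]: "coord (of_coords F) i j = F i j"
  by (simp add: coord_def of_coords_def)

lemma coord_ext: "(\<And>i j. coord f i j = coord g i j) \<Longrightarrow> f = g"
  unfolding coord_def by (rule ext) (metis prod_decode_inverse surj_pair)

text \<open>Positivity of \<open>d\<close> provides the variable y_1, whose ideal serves as the
  module.\<close>

locale two_blocks = field K for K (structure) +
  fixes c d :: nat
  assumes d_pos: "0 < d"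
begin

text \<open>\<open>A = K[x\<^sub>1, \<dots>, x\<^sub>c]/(x)\<^sup>2 \<otimes> K[y\<^sub>1, \<dots>, y\<^sub>d]/(y)\<^sup>2\<close>; with \<open>x\<^sub>0 = y\<^sub>0 = 1\<close>, the coordinate at
  \<open>(i, j)\<close> is the coefficient of \<open>x\<^sub>i y\<^sub>j\<close>.\<close>

definition A :: "('a, nat \<Rightarrow> 'a) module"
  where "A =
    \<lparr>carrier = {f. \<forall>i j. coord f i j \<in> carrier K \<and> (c < i \<or> d < j \<longrightarrow> coord f i j = \<zero>)},
     mult = (\<lambda>f g. of_coords (\<lambda>i j.
       if i = 0 \<and> j = 0 then coord f 0 0 \<otimes> coord g 0 0
       else if i = 0 \<or> j = 0 then coord f 0 0 \<otimes> coord g i j \<oplus> coord f i j \<otimes> coord g 0 0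
       else (coord f 0 0 \<otimes> coord g i j \<oplus> coord f i j \<otimes> coord g 0 0) \<oplus>
         (coord f i 0 \<otimes> coord g 0 j \<oplus> coord f 0 j \<otimes> coord g i 0))),
     one = of_coords (\<lambda>i j. if i = 0 \<and> j = 0 then \<one> else \<zero>), zero = of_coords (\<lambda>i j. \<zero>),
     add = (\<lambda>f g. of_coords (\<lambda>i j. coord f i j \<oplus> coord g i j)), smult = (\<lambda>l f. of_coords (\<lambda>i j. l \<otimes> coord f i j))\<rparr>"

lemma carrier_A: "f \<in> carrier A \<longleftrightarrow>
    (\<forall>i j. coord f i j \<in> carrier K) \<and> (\<forall>i j. c < i \<or> d < j \<longrightarrow> coord f i j = \<zero>)"
  by (auto simp: A_def)

lemma coord_closed [simp, intro]: "f \<in> carrier A \<Longrightarrow> coord f i j \<in> carrier K"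
  by (simp add: carrier_A)

lemma coord_A [simp]:
  "coord \<zero>\<^bsub>A\<^esub> i j = \<zero>" "coord \<one>\<^bsub>A\<^esub> i j = (if i = 0 \<and> j = 0 then \<one> else \<zero>)"
  "coord (f \<oplus>\<^bsub>A\<^esub> g) i j = coord f i j \<oplus> coord g i j" "coord (l \<odot>\<^bsub>A\<^esub> f) i j = l \<otimes> coord f i j"
  unfolding A_def by simp_all

text \<open>Products of two x's or of two y's vanish, so x_i y_j with positive indices arises only
  as 1 times itself, itself times 1, x_i times y_j, and y_j times x_i.\<close>

lemma coord_mult: "coord (f \<otimes>\<^bsub>A\<^esub> g) i j =
  (if i = 0 \<and> j = 0 then coord f 0 0 \<otimes> coord g 0 0
   else if i = 0 \<or> j = 0 then coord f 0 0 \<otimes> coord g i j \<oplus> coord f i j \<otimes> coord g 0 0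
   else (coord f 0 0 \<otimes> coord g i j \<oplus> coord f i j \<otimes> coord g 0 0) \<oplus>
     (coord f i 0 \<otimes> coord g 0 j \<oplus> coord f 0 j \<otimes> coord g i 0))"
  unfolding A_def by simp

lemma A_cring: "cring A"
proof (rule cringI)
  show "abelian_group A"
  proof (rule abelian_groupI)
    fix f assume "f \<in> carrier A"
    then show "\<exists>g\<in>carrier A. g \<oplus>\<^bsub>A\<^esub> f = \<zero>\<^bsub>A\<^esub>"
      by (intro bexI[of _ "of_coords (\<lambda>i j. \<ominus> coord f i j)"]) (auto simp: carrier_A l_neg intro: coord_ext)
  qed (auto intro!: coord_ext simp: carrier_A a_ac)
  show "comm_monoid A"
  proof (rule comm_monoidI)
    fix f g h assume fgh: "f \<in> carrier A" "g \<in> carrier A" "h \<in> carrier A"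
    show "f \<otimes>\<^bsub>A\<^esub> g \<otimes>\<^bsub>A\<^esub> h = f \<otimes>\<^bsub>A\<^esub> (g \<otimes>\<^bsub>A\<^esub> h)"
      using fgh by (intro coord_ext) (simp add: coord_mult l_distr r_distr m_ac a_ac)
  next
    fix f g assume fg: "f \<in> carrier A" "g \<in> carrier A"
    show "f \<otimes>\<^bsub>A\<^esub> g \<in> carrier A"
      unfolding carrier_A using fg by (auto simp: coord_mult) (auto simp: carrier_A)
    show "f \<otimes>\<^bsub>A\<^esub> g = g \<otimes>\<^bsub>A\<^esub> f"
      using fg by (intro coord_ext) (simp add: coord_mult m_ac a_ac)
  next
    show "\<one>\<^bsub>A\<^esub> \<in> carrier A" by (simp add: carrier_A)
    fix f assume "f \<in> carrier A"
    then show "\<one>\<^bsub>A\<^esub> \<otimes>\<^bsub>A\<^esub> f = f"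
      by (intro coord_ext) (simp add: coord_mult)
  qed
  fix f g h assume fgh: "f \<in> carrier A" "g \<in> carrier A" "h \<in> carrier A"
  show "(f \<oplus>\<^bsub>A\<^esub> g) \<otimes>\<^bsub>A\<^esub> h = f \<otimes>\<^bsub>A\<^esub> h \<oplus>\<^bsub>A\<^esub> g \<otimes>\<^bsub>A\<^esub> h"
    using fgh by (intro coord_ext) (simp add: coord_mult l_distr a_ac)
qed

sublocale A: cring A
  by (rule A_cring)

sublocale reg: left_module A "regular_module A"
  by (rule ring_regular_module[OF A.ring_axioms])

lemma coord_minus [simp]:
  assumes "f \<in> carrier A" "g \<in> carrier A"
  shows "coord (f \<ominus>\<^bsub>A\<^esub> g) i j = coord f i j \<ominus> coord g i j"
proof -
  have "\<ominus>\<^bsub>A\<^esub> g = of_coords (\<lambda>i j. \<ominus> coord g i j)"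
    using assms by (intro A.minus_equality coord_ext) (auto simp: carrier_A l_neg)
  then show ?thesis by (simp add: a_minus_def)
qed

lemma A_smult_closed [simp]: "l \<in> carrier K \<Longrightarrow> f \<in> carrier A \<Longrightarrow> l \<odot>\<^bsub>A\<^esub> f \<in> carrier A"
  by (simp add: carrier_A)

lemma A_module: "module K A"
  by (rule moduleI)
    (auto intro!: coord_ext is_cring A.abelian_group_axioms simp: l_distr r_distr m_assoc)

lemma A_algebra: "k_algebra K A"
  unfolding k_algebra_def using field_axioms A.ring_axioms A_module
  by (auto intro!: coord_ext simp: coord_mult r_distr l_distr m_ac a_ac)

section \<open>Subspaces spanned by monomials\<close>

definition supp_in :: "(nat \<times> nat) set \<Rightarrow> (nat \<Rightarrow> 'a) set"
  where "supp_in T = {f \<in> carrier A. \<forall>i j. (i, j) \<notin> T \<longrightarrow> coord f i j = \<zero>}"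

text \<open>The condition for the monomials in \<open>T\<close> to span an ideal: the proper
  divisors of x_i y_j are 1, x_i and y_j, and the divisor 1 is covered by the cases with
  \<open>i = 0\<close> or \<open>j = 0\<close>.\<close>

definition up_closed :: "(nat \<times> nat) set \<Rightarrow> bool"
  where "up_closed T \<longleftrightarrow> (\<forall>i\<le>c. \<forall>j\<le>d. (i, 0) \<in> T \<or> (0, j) \<in> T \<longrightarrow> (i, j) \<in> T)"

text \<open>The term k x_i y_j; despite the name it is usually not invertible.\<close>

definition unit :: "nat \<Rightarrow> nat \<Rightarrow> 'a \<Rightarrow> nat \<Rightarrow> 'a"
  where "unit i j k = of_coords (\<lambda>i' j'. if i' = i \<and> j' = j then k else \<zero>)"

lemma coord_unit [simp]: "coord (unit i j k) i' j' = (if i' = i \<and> j' = j then k else \<zero>)"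
  by (simp add: unit_def)

lemma unit_closed [simp]:
  "i \<le> c \<Longrightarrow> j \<le> d \<Longrightarrow> k \<in> carrier K \<Longrightarrow> unit i j k \<in> carrier A"
  by (auto simp: carrier_A)

lemma unit_mult:
  "k \<in> carrier K \<Longrightarrow> l \<in> carrier K \<Longrightarrow> unit i 0 k \<otimes>\<^bsub>A\<^esub> unit 0 j l = unit i j (k \<otimes> l)"
  by (rule coord_ext) (auto simp: coord_mult)

lemma unit_00_mult:
  "k \<in> carrier K \<Longrightarrow> f \<in> carrier A \<Longrightarrow> unit 0 0 k \<otimes>\<^bsub>A\<^esub> f = k \<odot>\<^bsub>A\<^esub> f"
  by (rule coord_ext) (auto simp: coord_mult)

lemma supp_in_carrier: "f \<in> supp_in T \<Longrightarrow> f \<in> carrier A"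
  by (simp add: supp_in_def)

lemma supp_in_mono: "T \<subseteq> T' \<Longrightarrow> supp_in T \<subseteq> supp_in T'"
  by (auto simp: supp_in_def)

text \<open>Coordinates outside the box vanish on \<open>carrier A\<close>. Infinite index sets are
  thus convenient in definitions and can be cut down to finite ones for induction and
  counting.\<close>

lemma supp_in_index:
  assumes "T \<inter> {..c} \<times> {..d} = T' \<inter> {..c} \<times> {..d}"
  shows "supp_in T = supp_in T'"
proof -
  have sub: "supp_in X \<subseteq> supp_in Y" if eq: "X \<inter> {..c} \<times> {..d} = Y \<inter> {..c} \<times> {..d}" for X Y
  proof
    fix f assume "f \<in> supp_in X"
    then have f: "f \<in> carrier A" "\<forall>i j. (i, j) \<notin> X \<longrightarrow> coord f i j = \<zero>"
      by (simp_all add: supp_in_def)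
    have "coord f i j = \<zero>" if "(i, j) \<notin> Y" for i j
    proof (cases "i \<le> c \<and> j \<le> d")
      case True
      then have "(i, j) \<notin> X" using that eq by blast
      then show ?thesis using f(2) by simp
    next
      case False
      then show ?thesis using f(1) by (auto simp: carrier_A)
    qed
    then show "f \<in> supp_in Y" using f(1) by (simp add: supp_in_def)
  qed
  show ?thesis
    by (rule equalityI[OF sub[OF assms] sub[OF assms[symmetric]]])
qed

lemma supp_in_UNIV: "supp_in UNIV = carrier A"
  by (simp add: supp_in_def)

lemma supp_in_empty: "supp_in {} = {\<zero>\<^bsub>A\<^esub>}"
  by (auto simp: supp_in_def intro: coord_ext)

lemma unit_in_supp:
  "(i, j) \<in> T \<Longrightarrow> i \<le> c \<Longrightarrow> j \<le> d \<Longrightarrow> k \<in> carrier K \<Longrightarrow> unit i j k \<in> supp_in T"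
  by (auto simp: supp_in_def)

lemma supp_in_zero: "\<zero>\<^bsub>A\<^esub> \<in> supp_in T"
  by (simp add: supp_in_def)

lemma supp_in_add: "f \<in> supp_in T \<Longrightarrow> g \<in> supp_in T \<Longrightarrow> f \<oplus>\<^bsub>A\<^esub> g \<in> supp_in T"
  by (simp add: supp_in_def)

lemma supp_in_mult:
  assumes "up_closed T" "a \<in> carrier A" "f \<in> supp_in T"
  shows "a \<otimes>\<^bsub>A\<^esub> f \<in> supp_in T"
proof -
  have f: "f \<in> carrier A" "\<And>i j. (i, j) \<notin> T \<Longrightarrow> coord f i j = \<zero>"
    using assms(3) by (auto simp: supp_in_def)
  have "coord (a \<otimes>\<^bsub>A\<^esub> f) i j = \<zero>" if "(i, j) \<notin> T" for i j
  proof (cases "i \<le> c \<and> j \<le> d")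
    case True
    \<comment> \<open>The index \<open>(0, 0)\<close> is excluded in two steps: 1 in
      \<open>T\<close> would force x_i and then x_i y_j into \<open>T\<close>.\<close>
    then have "(i, 0) \<notin> T" "(0, j) \<notin> T" "(0, 0) \<notin> T"
      using that assms(1) unfolding up_closed_def by blast+
    then show ?thesis
      using that f assms(2) by (simp add: coord_mult)
  next
    case False
    moreover have "a \<otimes>\<^bsub>A\<^esub> f \<in> carrier A" using assms(2) f(1) by simp
    ultimately show ?thesis by (auto simp: carrier_A)
  qed
  then show ?thesis
    using assms(2) f(1) by (simp add: supp_in_def)
qed

lemma supp_in_submodule: "up_closed T \<Longrightarrow> submodule (supp_in T) A (regular_module A)"
  unfolding reg.submodule_iff
  by (auto simp: regular_module_def supp_in_zero supp_in_add supp_in_mult supp_in_carrier)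

lemma supp_in_ideal:
  assumes "up_closed T"
  shows "ideal (supp_in T) A"
proof (rule idealI)
  show "ring A" by (rule A.ring_axioms)
  show "subgroup (supp_in T) (add_monoid A)"
    using submodule.axioms(1)[OF supp_in_submodule[OF assms]]
    by (simp add: subgroup_def regular_module_def m_inv_def)
  show "x \<otimes>\<^bsub>A\<^esub> f \<in> supp_in T" "f \<otimes>\<^bsub>A\<^esub> x \<in> supp_in T" if "f \<in> supp_in T" "x \<in> carrier A" for f x
    using supp_in_mult[OF assms that(2,1)] that by (simp_all add: A.m_comm supp_in_carrier)
qed

text \<open>Stands in for writing an element as a finite sum of terms: the induction removes one
  monomial from the support at a time.\<close>

lemma supp_in_induct:
  assumes T: "T \<subseteq> {..c} \<times> {..d}" and zero: "\<zero>\<^bsub>A\<^esub> \<in> S"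
    and add: "\<And>x y. x \<in> S \<Longrightarrow> y \<in> S \<Longrightarrow> x \<oplus>\<^bsub>A\<^esub> y \<in> S"
    and unit: "\<And>i j k. (i, j) \<in> T \<Longrightarrow> k \<in> carrier K \<Longrightarrow> unit i j k \<in> S"
  shows "supp_in T \<subseteq> S"
proof -
  have "finite T" using T by (rule finite_subset) simp
  then show ?thesis using T unit
  proof (induction T)
    case empty
    then show ?case using zero by (simp add: supp_in_empty)
  next
    case (insert p T)
    obtain i j where p: "p = (i, j)" by force
    show ?case
    proof
      fix f assume f: "f \<in> supp_in (insert p T)"
      then have fA: "f \<in> carrier A" by (rule supp_in_carrier)
      let ?g = "of_coords (\<lambda>i' j'. if (i', j') = p then \<zero> else coord f i' j')"
      have "?g \<in> supp_in T"
        using f by (auto simp: supp_in_def carrier_A)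
      then have "?g \<in> S" using insert by auto
      then have "?g \<oplus>\<^bsub>A\<^esub> unit i j (coord f i j) \<in> S"
        using insert.prems fA p by (intro add) auto
      moreover have "?g \<oplus>\<^bsub>A\<^esub> unit i j (coord f i j) = f"
        using fA p by (intro coord_ext) auto
      ultimately show "f \<in> S" by simp
    qed
  qed
qed

section \<open>The radical and its powers\<close>

text \<open>The monomials of degree at least \<open>m\<close>: each nonzero index contributes one
  variable.\<close>

definition filt :: "nat \<Rightarrow> (nat \<times> nat) set"
  where "filt m = {(i, j). m \<le> of_bool (i \<noteq> 0) + of_bool (j \<noteq> 0)}"

lemma filt_iff: "(i, j) \<in> filt m \<longleftrightarrow> m \<le> of_bool (i \<noteq> 0) + of_bool (j \<noteq> 0)"
  by (simp add: filt_def)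

lemma filt_0: "filt 0 = UNIV"
  by (auto simp: filt_def)

lemma filt_ge_3: "3 \<le> m \<Longrightarrow> filt m = {}"
  by (auto simp: filt_def)

lemma filt_up_closed: "up_closed (filt m)"
  by (auto simp: up_closed_def filt_def)

lemma filt_mono: "m \<le> n \<Longrightarrow> filt n \<subseteq> filt m"
  by (auto simp: filt_def)

lemma supp_in_filt_1: "f \<in> supp_in (filt (Suc 0)) \<longleftrightarrow> f \<in> carrier A \<and> coord f 0 0 = \<zero>"
proof -
  have "(i, j) \<notin> filt (Suc 0) \<longleftrightarrow> i = 0 \<and> j = 0" for i j
    by (simp add: filt_iff)
  then show ?thesis by (simp add: supp_in_def)
qed

lemma filt_mult:
  assumes "f \<in> supp_in (filt 1)" "g \<in> supp_in (filt m)"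
  shows "f \<otimes>\<^bsub>A\<^esub> g \<in> supp_in (filt (Suc m))"
proof -
  have f: "f \<in> carrier A" "coord f 0 0 = \<zero>"
    using assms(1) by (simp_all add: supp_in_filt_1)
  have g: "g \<in> carrier A"
    "\<And>i j. \<not> m \<le> of_bool (i \<noteq> 0) + of_bool (j \<noteq> 0) \<Longrightarrow> coord g i j = \<zero>"
    using assms(2) by (auto simp: supp_in_def filt_def)
  have "coord (f \<otimes>\<^bsub>A\<^esub> g) i j = \<zero>" if "(i, j) \<notin> filt (Suc m)" for i j
    using that f g(1) g(2)[of 0 0] g(2)[of i 0] g(2)[of 0 j]
    by (auto simp: coord_mult filt_def split: if_splits)
  then show ?thesis
    using f(1) g(1) by (simp add: supp_in_def)
qed

text \<open>Geometric series: after scaling the constant coefficient to 1, the element is 1 - n with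
  n of positive degree, hence n^3 = 0 and 1 + n + n^2 is an inverse.\<close>

lemma left_inverse:
  assumes f: "f \<in> carrier A" "coord f 0 0 \<noteq> \<zero>"
  shows "\<exists>g\<in>carrier A. g \<otimes>\<^bsub>A\<^esub> f = \<one>\<^bsub>A\<^esub>"
proof -
  let ?u = "inv (coord f 0 0)"
  have u: "?u \<in> carrier K" "?u \<otimes> coord f 0 0 = \<one>"
    using f by (auto simp: field_Units intro: Units_l_inv)
  define n where "n = \<one>\<^bsub>A\<^esub> \<ominus>\<^bsub>A\<^esub> ?u \<odot>\<^bsub>A\<^esub> f"
  have n: "n \<in> supp_in (filt 1)"
    using f u by (simp add: n_def supp_in_filt_1 r_neg minus_eq)
  then have nA: "n \<in> carrier A" by (rule supp_in_carrier)
  have "n \<otimes>\<^bsub>A\<^esub> n \<in> supp_in (filt (Suc 1))"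
    by (intro filt_mult n)
  then have "n \<otimes>\<^bsub>A\<^esub> (n \<otimes>\<^bsub>A\<^esub> n) \<in> supp_in (filt (Suc (Suc 1)))"
    by (intro filt_mult n)
  then have n3: "n \<otimes>\<^bsub>A\<^esub> (n \<otimes>\<^bsub>A\<^esub> n) = \<zero>\<^bsub>A\<^esub>"
    by (simp add: filt_ge_3 supp_in_empty)
  let ?g = "\<one>\<^bsub>A\<^esub> \<oplus>\<^bsub>A\<^esub> (n \<oplus>\<^bsub>A\<^esub> n \<otimes>\<^bsub>A\<^esub> n)"
  let ?h = "unit 0 0 ?u"
  have h: "?h \<in> carrier A" "?h \<otimes>\<^bsub>A\<^esub> f = \<one>\<^bsub>A\<^esub> \<ominus>\<^bsub>A\<^esub> n"
  proof -
    show "?h \<in> carrier A" using u by simp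
    have uf: "?u \<odot>\<^bsub>A\<^esub> f \<in> carrier A" using u f by simp
    have "\<one>\<^bsub>A\<^esub> \<ominus>\<^bsub>A\<^esub> (\<one>\<^bsub>A\<^esub> \<ominus>\<^bsub>A\<^esub> x) = x" if "x \<in> carrier A" for x
      using that by algebra
    from this[OF uf] show "?h \<otimes>\<^bsub>A\<^esub> f = \<one>\<^bsub>A\<^esub> \<ominus>\<^bsub>A\<^esub> n"
      using u f by (simp add: n_def unit_00_mult)
  qed
  have "?g \<otimes>\<^bsub>A\<^esub> (\<one>\<^bsub>A\<^esub> \<ominus>\<^bsub>A\<^esub> n) = \<one>\<^bsub>A\<^esub> \<ominus>\<^bsub>A\<^esub> n \<otimes>\<^bsub>A\<^esub> (n \<otimes>\<^bsub>A\<^esub> n)"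
    using nA by algebra
  also have "\<dots> = \<one>\<^bsub>A\<^esub>"
    using nA n3 by (simp add: a_minus_def)
  finally have "?g \<otimes>\<^bsub>A\<^esub> ?h \<otimes>\<^bsub>A\<^esub> f = \<one>\<^bsub>A\<^esub>"
    using h f nA by (simp add: A.m_assoc)
  moreover have "?g \<otimes>\<^bsub>A\<^esub> ?h \<in> carrier A" using nA h by simp
  ultimately show ?thesis by blast
qed

text \<open>An element with nonzero constant coefficient is invertible, so every proper left ideal
  lies in the set of elements with constant coefficient zero, which is itself a proper
  ideal.\<close>

lemma maximal_left_ideal_iff: "maximal_left_ideal A m \<longleftrightarrow> m = supp_in (filt 1)"
proof -
  have max: "L \<subseteq> supp_in (filt 1)" if L: "submodule L A (regular_module A)" "L \<noteq> carrier A" for L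
  proof
    fix f assume f: "f \<in> L"
    have LA: "L \<subseteq> carrier A" "\<And>a x. a \<in> carrier A \<Longrightarrow> x \<in> L \<Longrightarrow> a \<otimes>\<^bsub>A\<^esub> x \<in> L"
      using reg.submoduleD[OF L(1)] by (auto simp: regular_module_def)
    have "coord f 0 0 = \<zero>"
    proof (rule ccontr)
      assume "coord f 0 0 \<noteq> \<zero>"
      then obtain g where "g \<in> carrier A" "g \<otimes>\<^bsub>A\<^esub> f = \<one>\<^bsub>A\<^esub>"
        using left_inverse[of f] f LA(1) by auto
      then have "\<one>\<^bsub>A\<^esub> \<in> L" using LA(2) f by metis
      then have "a \<in> L" if "a \<in> carrier A" for a
        using LA(2)[OF that] A.r_one[OF that] by metis
      then show False using LA(1) L(2) by blast
    qed
    then show "f \<in> supp_in (filt 1)"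
      using f LA(1) by (auto simp: supp_in_filt_1)
  qed
  have J: "submodule (supp_in (filt 1)) A (regular_module A)"
    by (intro supp_in_submodule filt_up_closed)
  have "\<one>\<^bsub>A\<^esub> \<notin> supp_in (filt 1)"
    by (simp add: supp_in_filt_1)
  then have J1: "supp_in (filt 1) \<noteq> carrier A" by (metis A.one_closed)
  show ?thesis
    unfolding maximal_left_ideal_def using max J J1
    by (metis subset_antisym)
qed

lemma A_local: "local_ring A"
  using A.ring_axioms by (simp add: local_ring_def maximal_left_ideal_iff)

lemma radical_A: "radical A = supp_in (filt 1)"
  by (auto simp: radical_def maximal_left_ideal_iff supp_in_carrier)

text \<open>Every monomial of degree above \<open>m\<close> factors into one of positive degree and
  one of degree at least \<open>m\<close>; a set closed under sums and containing all such products
  therefore contains J^(m+1).\<close>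

lemma supp_in_filt_Suc:
  assumes S: "\<zero>\<^bsub>A\<^esub> \<in> S" "\<And>x y. x \<in> S \<Longrightarrow> y \<in> S \<Longrightarrow> x \<oplus>\<^bsub>A\<^esub> y \<in> S"
    and mult: "\<And>f g. f \<in> supp_in (filt 1) \<Longrightarrow> g \<in> supp_in (filt m) \<Longrightarrow> f \<otimes>\<^bsub>A\<^esub> g \<in> S"
  shows "supp_in (filt (Suc m)) \<subseteq> S"
proof -
  have "unit i j k \<in> S" if ij: "(i, j) \<in> filt (Suc m) \<inter> {..c} \<times> {..d}" and k: "k \<in> carrier K" for i j k
  proof (cases "i = 0")
    case False
    have "unit i 0 k \<otimes>\<^bsub>A\<^esub> unit 0 j \<one> \<in> S"
      using ij k False by (intro mult unit_in_supp) (auto simp: filt_def)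
    then show ?thesis using k by (simp add: unit_mult)
  next
    \<comment> \<open>Without an x the degree is at most one, so \<open>m = 0\<close> and 1 is
      allowed as second factor. The commutation afterwards restores the order of factors in
      \<open>unit_mult\<close>.\<close>
    case True
    then have "unit 0 j k \<otimes>\<^bsub>A\<^esub> unit 0 0 \<one> \<in> S"
      using ij k by (intro mult unit_in_supp) (auto simp: filt_def of_bool_def split: if_splits)
    moreover have "unit 0 j k \<otimes>\<^bsub>A\<^esub> unit 0 0 \<one> = unit 0 0 \<one> \<otimes>\<^bsub>A\<^esub> unit 0 j k"
      using ij k by (intro A.m_comm) auto
    ultimately show ?thesis using k True by (simp add: unit_mult)
  qed
  then have "supp_in (filt (Suc m) \<inter> {..c} \<times> {..d}) \<subseteq> S"
    by (intro supp_in_induct S) auto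
  then show ?thesis
    by (subst supp_in_index[of _ "filt (Suc m) \<inter> {..c} \<times> {..d}"]) auto
qed

lemma rad_pow_A: "rad_pow A m = supp_in (filt m)"
proof (induction m)
  case 0
  then show ?case by (simp add: filt_0 supp_in_UNIV)
next
  case (Suc m)
  have "ideal_prod A (supp_in (filt 1)) (supp_in (filt m)) = supp_in (filt (Suc m))"
  proof (intro equalityI subsetI)
    fix f assume "f \<in> ideal_prod A (supp_in (filt 1)) (supp_in (filt m))"
    then show "f \<in> supp_in (filt (Suc m))"
      by induction (simp_all add: filt_mult supp_in_add)
  next
    fix f assume "f \<in> supp_in (filt (Suc m))"
    \<comment> \<open>\<open>ideal_prod\<close> is generated by products and sums only, so zero has
      to appear as a product.\<close>
    moreover have "\<zero>\<^bsub>A\<^esub> \<otimes>\<^bsub>A\<^esub> \<zero>\<^bsub>A\<^esub> \<in> ideal_prod A (supp_in (filt 1)) (supp_in (filt m))"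
      by (intro ideal_prod.prod supp_in_zero)
    ultimately show "f \<in> ideal_prod A (supp_in (filt 1)) (supp_in (filt m))"
      using supp_in_filt_Suc[of "ideal_prod A (supp_in (filt 1)) (supp_in (filt m))" m]
      by (auto intro: ideal_prod.intros)
  qed
  then show ?case by (simp add: Suc radical_A)
qed

text \<open>Elements of the radical have constant coefficient zero, so the constant coefficient of a
  representative inverts the map.\<close>

lemma A_residue_field: "(\<lambda>l. radical A +>\<^bsub>A\<^esub> (l \<odot>\<^bsub>A\<^esub> \<one>\<^bsub>A\<^esub>)) \<in> ring_iso K (A Quot (radical A))"
proof -
  let ?J = "radical A"
  interpret J: ideal ?J A
    unfolding radical_A by (intro supp_in_ideal filt_up_closed)
  have "(\<lambda>l. l \<odot>\<^bsub>A\<^esub> \<one>\<^bsub>A\<^esub>) \<in> ring_hom K A"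
    by (rule ring_hom_memI) (auto intro!: coord_ext simp: coord_mult l_distr)
  then have "(+>\<^bsub>A\<^esub>) ?J \<circ> (\<lambda>l. l \<odot>\<^bsub>A\<^esub> \<one>\<^bsub>A\<^esub>) \<in> ring_hom K (A Quot ?J)"
    by (rule ring_hom_trans[OF _ J.rcos_ring_hom])
  then have "(\<lambda>l. ?J +>\<^bsub>A\<^esub> (l \<odot>\<^bsub>A\<^esub> \<one>\<^bsub>A\<^esub>)) \<in> ring_hom K (A Quot ?J)"
    by (simp add: o_def)
  moreover have "bij_betw (\<lambda>l. ?J +>\<^bsub>A\<^esub> (l \<odot>\<^bsub>A\<^esub> \<one>\<^bsub>A\<^esub>)) (carrier K) (carrier (A Quot ?J))"
  proof (rule bij_betwI')
    fix l l' assume l: "l \<in> carrier K" "l' \<in> carrier K"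
    show "(?J +>\<^bsub>A\<^esub> (l \<odot>\<^bsub>A\<^esub> \<one>\<^bsub>A\<^esub>) = ?J +>\<^bsub>A\<^esub> (l' \<odot>\<^bsub>A\<^esub> \<one>\<^bsub>A\<^esub>)) = (l = l')"
    proof
      assume "?J +>\<^bsub>A\<^esub> (l \<odot>\<^bsub>A\<^esub> \<one>\<^bsub>A\<^esub>) = ?J +>\<^bsub>A\<^esub> (l' \<odot>\<^bsub>A\<^esub> \<one>\<^bsub>A\<^esub>)"
      then have "l \<odot>\<^bsub>A\<^esub> \<one>\<^bsub>A\<^esub> \<in> ?J +>\<^bsub>A\<^esub> (l' \<odot>\<^bsub>A\<^esub> \<one>\<^bsub>A\<^esub>)"
        using J.a_rcos_self[of "l \<odot>\<^bsub>A\<^esub> \<one>\<^bsub>A\<^esub>"] l by simp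
      then obtain h where h: "h \<in> ?J" "l \<odot>\<^bsub>A\<^esub> \<one>\<^bsub>A\<^esub> = h \<oplus>\<^bsub>A\<^esub> (l' \<odot>\<^bsub>A\<^esub> \<one>\<^bsub>A\<^esub>)"
        by (auto simp: a_r_coset_def')
      have "coord (l \<odot>\<^bsub>A\<^esub> \<one>\<^bsub>A\<^esub>) 0 0 = coord (h \<oplus>\<^bsub>A\<^esub> (l' \<odot>\<^bsub>A\<^esub> \<one>\<^bsub>A\<^esub>)) 0 0"
        using h(2) by simp
      moreover have "coord h 0 0 = \<zero>"
        using h(1) by (simp add: radical_A supp_in_filt_1)
      ultimately show "l = l'" using l by simp
    qed simp
  next
    fix l assume "l \<in> carrier K"
    then show "?J +>\<^bsub>A\<^esub> (l \<odot>\<^bsub>A\<^esub> \<one>\<^bsub>A\<^esub>) \<in> carrier (A Quot ?J)"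
      by (auto simp: FactRing_def A_RCOSETS_def')
  next
    fix X assume "X \<in> carrier (A Quot ?J)"
    then obtain f where f: "f \<in> carrier A" "X = ?J +>\<^bsub>A\<^esub> f"
      by (auto simp: FactRing_def A_RCOSETS_def')
    let ?l = "coord f 0 0 \<odot>\<^bsub>A\<^esub> \<one>\<^bsub>A\<^esub>"
    have l: "?l \<in> carrier A" using f by simp
    have "f \<ominus>\<^bsub>A\<^esub> ?l \<in> ?J"
      unfolding radical_A One_nat_def supp_in_filt_1 using f l by (simp add: minus_eq r_neg)
    moreover have "f = (f \<ominus>\<^bsub>A\<^esub> ?l) \<oplus>\<^bsub>A\<^esub> ?l"
      using f l by algebra
    ultimately have "f \<in> ?J +>\<^bsub>A\<^esub> ?l"
      unfolding a_r_coset_def' by blast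
    then have "X = ?J +>\<^bsub>A\<^esub> ?l"
      using J.a_repr_independence' f l A.a_repr_independence' by metis
    then show "\<exists>l\<in>carrier K. X = ?J +>\<^bsub>A\<^esub> (l \<odot>\<^bsub>A\<^esub> \<one>\<^bsub>A\<^esub>)"
      using f by blast
  qed
  ultimately show ?thesis by (simp add: ring_iso_def)
qed

lemma A_finite_dimensional: "finite_dimensional K A"
proof -
  interpret AM: module K A by (rule A_module)
  let ?I = "{..c} \<times> {..d}" and ?e = "\<lambda>(i, j). unit i j \<one>"
  let ?B = "?e ` ?I"
  define S where "S = {x. \<exists>l \<in> ?B \<rightarrow> carrier K. x = (\<Oplus>\<^bsub>A\<^esub>b\<in>?B. l b \<odot>\<^bsub>A\<^esub> b)}"
  have B: "finite ?B" "?B \<subseteq> carrier A" by auto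
  have "supp_in ?I \<subseteq> S"
  proof (rule supp_in_induct)
    show "\<zero>\<^bsub>A\<^esub> \<in> S"
      unfolding S_def using B
      by (auto intro!: bexI[of _ "\<lambda>_. \<zero>"] simp: A.add.finprod_one_eqI subset_iff)
    show "x \<oplus>\<^bsub>A\<^esub> y \<in> S" if "x \<in> S" "y \<in> S" for x y
    proof -
      obtain l l' where l: "l \<in> ?B \<rightarrow> carrier K" "l' \<in> ?B \<rightarrow> carrier K"
        "x = (\<Oplus>\<^bsub>A\<^esub>b\<in>?B. l b \<odot>\<^bsub>A\<^esub> b)" "y = (\<Oplus>\<^bsub>A\<^esub>b\<in>?B. l' b \<odot>\<^bsub>A\<^esub> b)"
        using \<open>x \<in> S\<close> \<open>y \<in> S\<close> unfolding S_def by blast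
      have lB: "l b \<in> carrier K" "l' b \<in> carrier K" "b \<in> carrier A" if "b \<in> ?B" for b
        using that l(1,2) B by auto
      have "x \<oplus>\<^bsub>A\<^esub> y = (\<Oplus>\<^bsub>A\<^esub>b\<in>?B. l b \<odot>\<^bsub>A\<^esub> b \<oplus>\<^bsub>A\<^esub> l' b \<odot>\<^bsub>A\<^esub> b)"
        unfolding l(3,4) using lB by (intro A.finsum_addf[symmetric] Pi_I A_smult_closed)
      also have "\<dots> = (\<Oplus>\<^bsub>A\<^esub>b\<in>?B. (l b \<oplus> l' b) \<odot>\<^bsub>A\<^esub> b)"
        using lB by (intro A.finsum_cong' Pi_I A_smult_closed)
          (simp_all only: AM.smult_l_distr add.m_closed refl)
      finally show ?thesis
        unfolding S_def using lB by (auto intro!: bexI[of _ "\<lambda>b. l b \<oplus> l' b"])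
    qed
    fix i j k assume ij: "(i, j) \<in> ?I" and k: "k \<in> carrier K"
    define l where "l b = (if b = unit i j \<one> then k else \<zero>)" for b
    have "(\<Oplus>\<^bsub>A\<^esub>b\<in>?B. l b \<odot>\<^bsub>A\<^esub> b) = (\<Oplus>\<^bsub>A\<^esub>b\<in>?B. if unit i j \<one> = b then k \<odot>\<^bsub>A\<^esub> b else \<zero>\<^bsub>A\<^esub>)"
      using B k by (intro A.finsum_cong' Pi_I) (auto simp: l_def)
    also have "\<dots> = k \<odot>\<^bsub>A\<^esub> unit i j \<one>"
      using ij k B by (intro A.add.finprod_singleton) auto
    also have "\<dots> = unit i j k"
      using k by (intro coord_ext) auto
    finally show "unit i j k \<in> S"
      unfolding S_def using k by (auto intro!: bexI[of _ l] simp: l_def)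
  qed simp
  moreover have "supp_in ?I = carrier A"
    unfolding supp_in_UNIV[symmetric] by (rule supp_in_index) auto
  ultimately show ?thesis
    unfolding finite_dimensional_def S_def using B by blast
qed

lemma A_short_local: "short_local_algebra K A"
  unfolding short_local_algebra_def
  using A_algebra A_finite_dimensional A_local A_residue_field
  by (simp add: rad_pow_A filt_ge_3 supp_in_empty)

section \<open>Lengths of monomial ideals\<close>

text \<open>Adjoining one monomial enlarges the ideal by one dimension over \<open>K\<close>, so the
  step is simple. Demanding \<open>up_closed\<close> for all subsets of \<open>D\<close> permits
  adjoining in any order, as induction over a finite set requires.\<close>

lemma supp_in_chain:
  assumes "finite D" "D \<subseteq> {..c} \<times> {..d}" "D \<inter> T = {}" "\<And>E. E \<subseteq> D \<Longrightarrow> up_closed (T \<union> E)"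
  shows "submodule_chain A (regular_module A) (supp_in T) (supp_in (T \<union> D)) (card D)"
  using assms
proof (induction D)
  case empty
  then show ?case
    using supp_in_submodule[of T]
    by (intro submodule_chainI[of "\<lambda>_. supp_in T"]) force+
next
  case (insert p D)
  obtain i j where p: "p = (i, j)" by force
  let ?N = "supp_in (T \<union> D)" and ?N' = "supp_in (T \<union> insert p D)"
  have N: "submodule ?N A (regular_module A)" "submodule ?N' A (regular_module A)"
    using insert.prems(3)[of D] insert.prems(3)[of "insert p D"]
    by (auto intro: supp_in_submodule)
  have NN: "?N \<subseteq> ?N'" by (intro supp_in_mono) auto
  have "unit i j \<one> \<in> ?N'" "unit i j \<one> \<notin> ?N"
    using insert.prems insert.hyps p by (auto simp: supp_in_def)
  then have psub: "?N \<subset> ?N'" using NN by blast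
  have max: False
    if U: "submodule U A (regular_module A)" "?N \<subset> U" "U \<subset> ?N'" for U
  proof -
    obtain u where u: "u \<in> U" "u \<notin> ?N" using U(2) by blast
    have UN: "u \<in> ?N'" using u U(3) by blast
    then have uA: "u \<in> carrier A" by (rule supp_in_carrier)
    have up: "coord u i j \<noteq> \<zero>"
      using u UN p by (auto simp: supp_in_def)
    have "g \<in> U" if g: "g \<in> ?N'" for g
    proof -
      have gA: "g \<in> carrier A" using g by (rule supp_in_carrier)
      \<comment> \<open>The scalar that matches the coefficient of \<open>g\<close> at the new
        monomial: subtracting \<open>k\<close> times \<open>u\<close> from \<open>g\<close> leaves
        an element of the smaller ideal.\<close>
      define k where "k = coord g i j \<otimes> inv (coord u i j)"
      have iu: "inv (coord u i j) \<in> carrier K" "inv (coord u i j) \<otimes> coord u i j = \<one>"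
        using up uA by (auto simp: field_Units intro: Units_l_inv)
      have k: "k \<in> carrier K" "k \<otimes> coord u i j = coord g i j"
        using iu uA gA by (simp_all add: k_def m_assoc)
      let ?s = "unit 0 0 k \<otimes>\<^bsub>A\<^esub> u"
      have s: "?s \<in> U" "?s \<in> carrier A"
        using reg.submoduleD(4)[OF U(1), of "unit 0 0 k" u] u k uA by (simp_all add: regular_module_def)
      have "coord (g \<ominus>\<^bsub>A\<^esub> ?s) i' j' = \<zero>" if "(i', j') \<notin> T \<union> D" for i' j'
      proof (cases "(i', j') = p")
        case True
        then show ?thesis
          using k gA uA s(2) p by (simp add: unit_00_mult minus_eq r_neg)
      next
        case False
        then have "coord g i' j' = \<zero>" "coord u i' j' = \<zero>"
          using g UN that by (simp_all add: supp_in_def)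
        then show ?thesis
          using k gA uA s(2) by (simp add: unit_00_mult minus_eq)
      qed
      then have "g \<ominus>\<^bsub>A\<^esub> ?s \<in> ?N"
        using gA s(2) by (simp add: supp_in_def)
      then have "g \<ominus>\<^bsub>A\<^esub> ?s \<in> U" using U(2) by blast
      then have "?s \<oplus>\<^bsub>A\<^esub> (g \<ominus>\<^bsub>A\<^esub> ?s) \<in> U"
        using reg.submoduleD(3)[OF U(1), of ?s] s by (simp add: regular_module_def)
      then show ?thesis
        using A.add_eq_minus_iff[OF gA s(2)] by simp
    qed
    then show False using U(3) by blast
  qed
  have "submodule_chain A (regular_module A) ?N ?N' 1"
  proof (rule submodule_chainI[of "\<lambda>i. if i = 0 then ?N else ?N'"])
    show False if "i < 1" "submodule U A (regular_module A)"
      "(if i = 0 then ?N else ?N') \<subset> U" "U \<subset> (if Suc i = 0 then ?N else ?N')" for i U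
      using max that by simp
  qed (use N psub in auto)
  moreover have "submodule_chain A (regular_module A) (supp_in T) ?N (card D)"
  proof (rule insert.IH)
    show "up_closed (T \<union> E)" if "E \<subseteq> D" for E
      using that by (intro insert.prems(3)) auto
  qed (use insert.prems in auto)
  ultimately have "submodule_chain A (regular_module A) (supp_in T) ?N' (card D + 1)"
    by (intro submodule_chain_append)
  then show ?case
    using insert.hyps by simp
qed

lemma supp_in_chain':
  assumes "D \<subseteq> {..c} \<times> {..d}" "D \<inter> T = {}" "\<And>E. E \<subseteq> D \<Longrightarrow> up_closed (T \<union> E)"
    and "card D = n" "(T \<union> D) \<inter> {..c} \<times> {..d} = T' \<inter> {..c} \<times> {..d}"
  shows "submodule_chain A (regular_module A) (supp_in T) (supp_in T') n"
proof -
  have "finite D" using assms(1) by (rule finite_subset) simp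
  from supp_in_chain[OF this assms(1-3)] show ?thesis
    using assms(4) supp_in_index[OF assms(5)] by simp
qed

lemma zero_regular: "\<zero>\<^bsub>regular_module A\<^esub> = \<zero>\<^bsub>A\<^esub>"
  by (simp add: regular_module_def)

lemma has_length_supp:
  assumes "up_closed T" "submodule_chain A (regular_module A) (supp_in {}) (supp_in T) n"
  shows "has_length A ((regular_module A)\<lparr>carrier := supp_in T\<rparr>) n"
  using reg.submodule_chain_restrict[OF supp_in_submodule[OF assms(1)] assms(2)]
  by (simp add: has_length_iff_chain supp_in_empty zero_regular)

lemma has_length_supp_quot:
  assumes "up_closed T'" "submodule_chain A (regular_module A) (supp_in T) (supp_in T') n"
  shows "has_length A (quot_mod ((regular_module A)\<lparr>carrier := supp_in T'\<rparr>) (supp_in T)) n"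
  by (rule left_module.has_length_quot_mod[OF reg.submodule_left_module[OF supp_in_submodule[OF assms(1)]]])
    (use reg.submodule_chain_restrict[OF supp_in_submodule[OF assms(1)] assms(2)] in simp)

text \<open>J maps J^m into J^(m+1), so any monomials of degree at least \<open>m\<close> may be
  adjoined to J^(m+1) without losing the ideal property.\<close>

lemma up_closed_filt_Un:
  assumes "E \<subseteq> filt m"
  shows "up_closed (filt (Suc m) \<union> E)"
  unfolding up_closed_def
proof (intro allI impI)
  fix i j
  assume ij: "(i, 0) \<in> filt (Suc m) \<union> E \<or> (0, j) \<in> filt (Suc m) \<union> E"
  then have "(i, 0) \<in> filt m \<or> (0, j) \<in> filt m"
    using assms filt_mono[of m "Suc m"] by (meson Un_iff lessI less_imp_le subsetD)
  then have "(i, j) \<in> filt (Suc m)" if "i \<noteq> 0" "j \<noteq> 0"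
    using that by (auto simp: filt_iff)
  \<comment> \<open>If 1 is adjoined then \<open>filt (Suc m)\<close> already holds every other
    monomial.\<close>
  moreover have "m = 0" if "(0, 0) \<in> E"
    using assms that by (auto simp: filt_iff dest: subsetD)
  ultimately show "(i, j) \<in> filt (Suc m) \<union> E"
    using ij by (cases "i = 0"; cases "j = 0") (auto simp: filt_iff)
qed

text \<open>The condition is vacuous, since monomials x_i y_j with both indices positive have no
  nonzero proper multiples. The form \<open>{} \<union> E\<close> fits \<open>supp_in_chain'\<close>
  with \<open>T\<close> empty.\<close>

lemma up_closed_inner:
  assumes "E \<subseteq> {(i, j). i \<noteq> 0 \<and> j \<noteq> 0}"
  shows "up_closed ({} \<union> E)"
proof -
  have "(i, 0) \<notin> E" "(0, i) \<notin> E" for i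
    using assms by blast+
  then show ?thesis by (simp add: up_closed_def)
qed

text \<open>Degree one consists of the c + d variables, degree two of the c d products x_i
  y_j.\<close>

lemma A_hilbert_type: "hilbert_type A (c + d, c * d)"
proof -
  let ?D = "{1..c} \<times> {0} \<union> {0} \<times> {1..d}"
  have "submodule_chain A (regular_module A) (supp_in (filt 2)) (supp_in (filt 1)) (c + d)"
  proof (rule supp_in_chain'[of ?D])
    show "up_closed (filt 2 \<union> E)" if "E \<subseteq> ?D" for E
    proof -
      have "?D \<subseteq> filt 1" by (auto simp: filt_iff)
      with that have "E \<subseteq> filt 1" by (rule subset_trans)
      from up_closed_filt_Un[OF this] show ?thesis by (simp add: numeral_2_eq_2)
    qed
    have "card ?D = card ({1..c} \<times> {0::nat}) + card ({0::nat} \<times> {1..d})"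
      by (intro card_Un_disjoint) auto
    then show "card ?D = c + d" by (simp add: card_cartesian_product)
  qed (auto simp: filt_def of_bool_def split: if_splits)
  moreover have "submodule_chain A (regular_module A) (supp_in {}) (supp_in (filt 2)) (c * d)"
  proof (rule supp_in_chain'[of "{1..c} \<times> {1..d}"])
    show "up_closed ({} \<union> E)" if "E \<subseteq> {1..c} \<times> {1..d}" for E
      by (rule up_closed_inner, rule subset_trans[OF that]) auto
  qed (auto simp: filt_def card_cartesian_product of_bool_def split: if_splits)
  ultimately show ?thesis
    unfolding hilbert_type_def rad_pow_A radical_A
    using has_length_supp_quot[OF filt_up_closed] has_length_supp[OF filt_up_closed] by simp
qed

section \<open>The module\<close>

text \<open>The multiples of y_1 whose cofactor has degree at least \<open>m\<close>: y_1 and all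
  x_i y_1 for \<open>m = 0\<close>, only the latter for \<open>m = 1\<close>, nothing
  beyond.\<close>

definition col :: "nat \<Rightarrow> (nat \<times> nat) set"
  where "col m = {(i, j). j = 1 \<and> m \<le> of_bool (i \<noteq> 0)}"

text \<open>The ideal \<open>A y\<^sub>1\<close>, which is isomorphic to \<open>A/(y\<^sub>1, \<dots>, y\<^sub>d)\<close>.\<close>

definition M :: "(nat \<Rightarrow> 'a, nat \<Rightarrow> 'a) module"
  where "M = (regular_module A)\<lparr>carrier := supp_in (col 0)\<rparr>"

lemma M_simps [simp]:
  "carrier M = supp_in (col 0)" "\<zero>\<^bsub>M\<^esub> = \<zero>\<^bsub>A\<^esub>" "f \<oplus>\<^bsub>M\<^esub> g = f \<oplus>\<^bsub>A\<^esub> g" "a \<odot>\<^bsub>M\<^esub> f = a \<otimes>\<^bsub>A\<^esub> f"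
  unfolding M_def regular_module_def by simp_all

lemma col_up_closed: "up_closed (col m)"
  by (auto simp: up_closed_def col_def)

lemma col_mono: "m \<le> n \<Longrightarrow> col n \<subseteq> col m"
  by (auto simp: col_def)

lemma M_left_module: "left_module A M"
  unfolding M_def by (intro reg.submodule_left_module supp_in_submodule col_up_closed)

lemma supp_in_colD:
  assumes "f \<in> supp_in (col m)"
  shows "f \<in> carrier A" "j \<noteq> 1 \<Longrightarrow> coord f i j = \<zero>" "\<not> m \<le> of_bool (i \<noteq> 0) \<Longrightarrow> coord f i j = \<zero>"
  using assms by (simp_all add: supp_in_def col_def)

lemma supp_in_filtD:
  assumes "f \<in> supp_in (filt m)"
  shows "f \<in> carrier A" "\<not> m \<le> of_bool (i \<noteq> 0) + of_bool (j \<noteq> 0) \<Longrightarrow> coord f i j = \<zero>"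
  using assms by (simp_all add: supp_in_def filt_def)

text \<open>On a multiple of y_1 only the y-free coefficients of the scalar act, and those of a
  scalar in J^m vanish below degree \<open>m\<close>. Conversely x_i y_1 is x_i times y_1.\<close>

lemma rad_mod_M: "rad_mod A m M = supp_in (col m)"
proof (intro equalityI subsetI)
  fix x assume "x \<in> rad_mod A m M"
  then show "x \<in> supp_in (col m)"
  proof induction
    case (smult f x)
    have f: "f \<in> supp_in (filt m)" and x: "x \<in> supp_in (col 0)"
      using smult by (simp_all add: rad_pow_A)
    have fx: "f \<otimes>\<^bsub>A\<^esub> x \<in> supp_in (col 0)"
      using supp_in_mult[OF col_up_closed supp_in_filtD(1)[OF f] x] .
    have "coord (f \<otimes>\<^bsub>A\<^esub> x) i j = \<zero>" if "(i, j) \<notin> col m" for i j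
    proof (cases "j = 1")
      case False
      then show ?thesis using supp_in_colD(2)[OF fx] by simp
    next
      case True
      then have "\<not> m \<le> of_bool (i \<noteq> 0)" using that by (simp add: col_def)
      then have "coord f i 0 = \<zero>" "coord f 0 0 = \<zero>"
        using supp_in_filtD(2)[OF f] by auto
      then show ?thesis
        using supp_in_filtD(1)[OF f] supp_in_colD(1,2)[OF x] True by (simp add: coord_mult)
    qed
    then show ?case
      using supp_in_carrier[OF fx] by (simp add: supp_in_def)
  qed (simp add: supp_in_add)
next
  fix x assume "x \<in> supp_in (col m)"
  also have "supp_in (col m) = supp_in (col m \<inter> {..c} \<times> {..d})"
    by (rule supp_in_index) auto
  also have "\<dots> \<subseteq> rad_mod A m M"
  proof (rule supp_in_induct)
    have "\<zero>\<^bsub>A\<^esub> \<odot>\<^bsub>M\<^esub> \<zero>\<^bsub>A\<^esub> \<in> rad_mod A m M"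
      by (intro ideal_smult.smult) (simp_all add: rad_pow_A supp_in_zero)
    then show "\<zero>\<^bsub>A\<^esub> \<in> rad_mod A m M" by simp
    show "x \<oplus>\<^bsub>A\<^esub> y \<in> rad_mod A m M" if "x \<in> rad_mod A m M" "y \<in> rad_mod A m M" for x y
      using ideal_smult.sum[OF that] by simp
    fix i j k assume ij: "(i, j) \<in> col m \<inter> {..c} \<times> {..d}" and k: "k \<in> carrier K"
    have "unit i 0 k \<odot>\<^bsub>M\<^esub> unit 0 j \<one> \<in> rad_mod A m M"
      unfolding rad_pow_A using ij k
      by (intro ideal_smult.smult) (auto simp: filt_def col_def intro!: unit_in_supp)
    then show "unit i j k \<in> rad_mod A m M"
      using k by (simp add: unit_mult)
  qed simp
  finally show "x \<in> rad_mod A m M" .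
qed

text \<open>The module has top spanned by y_1 and radical spanned by the \<open>c\<close> products
  x_i y_1; the two series give its dimension vector and, joined, its length.\<close>

lemma M_chains:
  "submodule_chain A (regular_module A) (supp_in {}) (supp_in (col 1)) c"
    "submodule_chain A (regular_module A) (supp_in (col 1)) (supp_in (col 0)) 1"
proof -
  show "submodule_chain A (regular_module A) (supp_in {}) (supp_in (col 1)) c"
  proof (rule supp_in_chain'[of "{1..c} \<times> {1}"])
    show "up_closed ({} \<union> E)" if "E \<subseteq> {1..c} \<times> {1}" for E
      by (rule up_closed_inner, rule subset_trans[OF that]) auto
  qed (use d_pos in \<open>auto simp: col_def card_cartesian_product of_bool_def split: if_splits\<close>)
  show "submodule_chain A (regular_module A) (supp_in (col 1)) (supp_in (col 0)) 1"
  proof (rule supp_in_chain'[of "{(0, 1)}"])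
    show "up_closed (col 1 \<union> E)" if "E \<subseteq> {(0, 1)}" for E
    proof -
      have "E = {} \<or> E = {(0, 1)}" using that by blast
      then show ?thesis by (auto simp: up_closed_def col_def)
    qed
  qed (use d_pos in \<open>auto simp: col_def of_bool_def split: if_splits\<close>)
qed

lemma M_length: "has_length A M (c + 1)"
  unfolding M_def
  by (intro has_length_supp col_up_closed submodule_chain_append[OF M_chains(1) M_chains(2)])

lemma M_dimension_vector: "dimension_vector A M (1, c)"
  unfolding dimension_vector_def rad_mod_M
  using has_length_supp_quot[OF col_up_closed M_chains(2)] has_length_supp[OF col_up_closed M_chains(1)]
  by (simp add: M_def)

lemma M_loewy: "loewy_length_at_most A M 2"
proof -
  have "col 2 = {}" by (auto simp: col_def)
  then show ?thesis
    by (simp add: loewy_length_at_most_def rad_mod_M supp_in_empty)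
qed

section \<open>The resolution\<close>

text \<open>Basis vectors stand for words of length \<open>n\<close> in y_1, ..., y_d, encoded as
  numbers with \<open>n\<close> digits in base \<open>d\<close>.\<close>

abbreviation P :: "nat \<Rightarrow> (nat \<Rightarrow> 'a, nat \<Rightarrow> nat \<Rightarrow> 'a) module"
  where "P n \<equiv> free_module A (d ^ n)"

lemma P_left_module: "left_module A (P n)"
  by (rule free_module_left_module[OF A.ring_axioms])

lemma P_carrier: "f \<in> carrier (P n) \<longleftrightarrow> (\<forall>w<d ^ n. f w \<in> carrier A) \<and> f \<in> extensional {..<d ^ n}"
  by (auto simp: free_module_def PiE_iff)

lemma P_closed: "f \<in> carrier (P n) \<Longrightarrow> w < d ^ n \<Longrightarrow> f w \<in> carrier A"
  by (simp add: P_carrier)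

lemma P_apply [simp]:
  assumes "w < d ^ n"
  shows "(f \<oplus>\<^bsub>P n\<^esub> g) w = f w \<oplus>\<^bsub>A\<^esub> g w" "(a \<odot>\<^bsub>P n\<^esub> f) w = a \<otimes>\<^bsub>A\<^esub> f w" "\<zero>\<^bsub>P n\<^esub> w = \<zero>\<^bsub>A\<^esub>"
  using assms by (simp_all add: free_module_def)

lemma P_add_closed: "f \<in> carrier (P n) \<Longrightarrow> g \<in> carrier (P n) \<Longrightarrow> f \<oplus>\<^bsub>P n\<^esub> g \<in> carrier (P n)"
  by (rule abelian_monoid.a_closed[OF abelian_group.axioms(1)[OF left_module.axioms(2)[OF P_left_module]]])

lemma P_smult_closed: "a \<in> carrier A \<Longrightarrow> f \<in> carrier (P n) \<Longrightarrow> a \<odot>\<^bsub>P n\<^esub> f \<in> carrier (P n)"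
  by (rule left_module.smult_closed[OF P_left_module])

lemma P_ext:
  assumes "f \<in> carrier (P n)" "g \<in> carrier (P n)"
    and "\<And>w i j. w < d ^ n \<Longrightarrow> coord (f w) i j = coord (g w) i j"
  shows "f = g"
proof (rule extensionalityI[of _ "{..<d ^ n}"])
  show "f \<in> extensional {..<d ^ n}" "g \<in> extensional {..<d ^ n}"
    using assms(1,2) by (simp_all add: P_carrier)
  show "f w = g w" if "w \<in> {..<d ^ n}" for w
    using that assms(3) by (intro coord_ext) simp
qed

section \<open>The radical filtration of the free modules\<close>

definition filtP :: "nat \<Rightarrow> nat \<Rightarrow> (nat \<Rightarrow> nat \<Rightarrow> 'a) set"
  where "filtP m n = {f \<in> carrier (P n). \<forall>w<d ^ n. f w \<in> supp_in (filt m)}"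

lemma filtP_iff: "f \<in> filtP m n \<longleftrightarrow> f \<in> carrier (P n) \<and>
    (\<forall>w<d ^ n. \<forall>i j. \<not> m \<le> of_bool (i \<noteq> 0) + of_bool (j \<noteq> 0) \<longrightarrow> coord (f w) i j = \<zero>)"
  by (auto simp: filtP_def supp_in_def filt_iff P_closed)

lemma filtP_carrier: "filtP m n \<subseteq> carrier (P n)"
  by (auto simp: filtP_def)

lemma filtP_0: "filtP 0 n = carrier (P n)"
  by (auto simp: filtP_iff)

lemma rad_mod_P: "rad_mod A m (P n) = filtP m n"
  unfolding rad_pow_A filtP_def
  by (rule ideal_smult_free_module[OF A.ring_axioms supp_in_ideal[OF filt_up_closed]])

lemma filtP_submodule: "submodule (filtP m n) A (P n)"
proof -
  interpret P: left_module A "P n" by (rule P_left_module)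
  show ?thesis
    unfolding P.submodule_iff
  proof (intro conjI ballI)
    show "filtP m n \<subseteq> carrier (P n)" by (rule filtP_carrier)
    show "\<zero>\<^bsub>P n\<^esub> \<in> filtP m n" by (simp add: filtP_def supp_in_zero)
    show "x \<oplus>\<^bsub>P n\<^esub> y \<in> filtP m n" if "x \<in> filtP m n" "y \<in> filtP m n" for x y
      using that by (simp add: filtP_def supp_in_add)
    show "a \<odot>\<^bsub>P n\<^esub> x \<in> filtP m n" if "a \<in> carrier A" "x \<in> filtP m n" for a x
      using that by (simp add: filtP_def supp_in_mult[OF filt_up_closed])
  qed
qed

text \<open>Nakayama's argument for a nilpotent radical: from P = U + S with S inside J P one gets P
  = U + J^m P for every \<open>m\<close>, and J^3 = 0 ends the descent.\<close>

lemma superfluous_P: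
  assumes S: "S \<subseteq> filtP 1 n"
  shows "superfluous A (P n) S"
  unfolding superfluous_def
proof (intro allI impI, elim conjE)
  fix U assume U: "submodule U A (P n)" and US: "U <+>\<^bsub>P n\<^esub> S = carrier (P n)"
  interpret P: left_module A "P n" by (rule P_left_module)
  note U = P.submoduleD[OF U]
  have UP: "u \<in> carrier (P n)" if "u \<in> U" for u using that U(1) by blast
  have FP: "s \<in> carrier (P n)" if "s \<in> filtP m n" for s m using that filtP_carrier by blast
  \<comment> \<open>For \<open>a\<close> in J^m and x = u + s the product \<open>a u\<close> stays
    in \<open>U\<close>, while \<open>a s\<close> gains a degree because \<open>s\<close> lies in J
    P.\<close>
  have step: "\<exists>u\<in>U. \<exists>s\<in>filtP (Suc m) n. f = u \<oplus>\<^bsub>P n\<^esub> s" if "f \<in> rad_mod A m (P n)" for f m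
    using that
  proof induction
    case (smult a x)
    obtain u s where us: "u \<in> U" "s \<in> S" "x = u \<oplus>\<^bsub>P n\<^esub> s"
      using smult(2) US unfolding set_add_def' by blast
    have s: "s \<in> filtP 1 n" using us S by blast
    have a: "a \<in> supp_in (filt m)" using smult(1) by (simp add: rad_pow_A)
    then have aA: "a \<in> carrier A" by (rule supp_in_carrier)
    have "a \<otimes>\<^bsub>A\<^esub> s w \<in> supp_in (filt (Suc m))" if "w < d ^ n" for w
    proof -
      have "s w \<in> supp_in (filt 1)" using s that by (simp add: filtP_def)
      with filt_mult[OF this a] show ?thesis
        using aA by (simp add: A.m_comm supp_in_carrier)
    qed
    then have "a \<odot>\<^bsub>P n\<^esub> s \<in> filtP (Suc m) n"
      using P_smult_closed[OF aA FP[OF s]] by (simp add: filtP_def)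
    moreover have "a \<odot>\<^bsub>P n\<^esub> x = a \<odot>\<^bsub>P n\<^esub> u \<oplus>\<^bsub>P n\<^esub> a \<odot>\<^bsub>P n\<^esub> s"
      using us aA UP FP[OF s] by (simp add: P.smult_r_distr)
    ultimately show ?case using U(4)[OF aA us(1)] by blast
  next
    case (sum x y)
    then obtain u s u' s' where us: "u \<in> U" "s \<in> filtP (Suc m) n" "x = u \<oplus>\<^bsub>P n\<^esub> s"
      "u' \<in> U" "s' \<in> filtP (Suc m) n" "y = u' \<oplus>\<^bsub>P n\<^esub> s'"
      by blast
    then have "x \<oplus>\<^bsub>P n\<^esub> y = (u \<oplus>\<^bsub>P n\<^esub> u') \<oplus>\<^bsub>P n\<^esub> (s \<oplus>\<^bsub>P n\<^esub> s')"
      using UP FP by (simp add: P.a_ac)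
    moreover have "s \<oplus>\<^bsub>P n\<^esub> s' \<in> filtP (Suc m) n"
      using us P.submoduleD(3)[OF filtP_submodule] by simp
    ultimately show ?case using U(3) us by blast
  qed
  have all: "\<exists>u\<in>U. \<exists>s\<in>filtP m n. f = u \<oplus>\<^bsub>P n\<^esub> s" if "f \<in> carrier (P n)" for f m
  proof (induction m)
    case 0
    have "f = \<zero>\<^bsub>P n\<^esub> \<oplus>\<^bsub>P n\<^esub> f" using that by simp
    then show ?case using U(2) that unfolding filtP_0 by blast
  next
    case (Suc m)
    then obtain u s where us: "u \<in> U" "s \<in> filtP m n" "f = u \<oplus>\<^bsub>P n\<^esub> s" by blast
    obtain u' s' where us': "u' \<in> U" "s' \<in> filtP (Suc m) n" "s = u' \<oplus>\<^bsub>P n\<^esub> s'"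
      using step[of s m] us(2) by (auto simp: rad_mod_P)
    have "f = (u \<oplus>\<^bsub>P n\<^esub> u') \<oplus>\<^bsub>P n\<^esub> s'"
      using us us' UP FP by (simp add: P.a_assoc)
    then show ?case using U(3) us(1) us'(1,2) by blast
  qed
  have "f \<in> U" if f: "f \<in> carrier (P n)" for f
  proof -
    obtain u s where us: "u \<in> U" "s \<in> filtP 3 n" "f = u \<oplus>\<^bsub>P n\<^esub> s"
      using all[OF f, of 3] by blast
    have "s = \<zero>\<^bsub>P n\<^esub>"
      using us(2) by (intro P_ext[of _ n]) (auto simp: filtP_def filt_ge_3 supp_in_empty)
    then show ?thesis using us UP by simp
  qed
  then show "U = carrier (P n)" using U(1) by blast
qed

section \<open>Differentials, augmentation and division by the y_j\<close>

text \<open>\<open>dif n\<close> sends the basis vector \<open>e\<^sub>q\<close> to \<open>y\<^sub>j e\<^sub>w\<close>, where \<open>q = w d + (j - 1)\<close> and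
  \<open>1 \<le> j \<le> d\<close>; \<open>eps\<close> sends \<open>e\<^sub>0\<close> to \<open>y\<^sub>1\<close>.  On an element of \<open>(y\<^sub>1, \<dots>, y\<^sub>d) P n\<close>,
  \<open>lift n\<close> is a section of \<open>dif n\<close>.\<close>

definition dif :: "nat \<Rightarrow> (nat \<Rightarrow> nat \<Rightarrow> 'a) \<Rightarrow> nat \<Rightarrow> nat \<Rightarrow> 'a"
  where "dif n f = (\<lambda>w\<in>{..<d ^ n}.
    of_coords (\<lambda>i j. if j = 0 \<or> d < j then \<zero> else coord (f (w * d + (j - 1))) i 0))"

definition eps :: "(nat \<Rightarrow> nat \<Rightarrow> 'a) \<Rightarrow> nat \<Rightarrow> 'a"
  where "eps f = of_coords (\<lambda>i j. if j = 1 then coord (f 0) i 0 else \<zero>)"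

definition lift :: "nat \<Rightarrow> (nat \<Rightarrow> nat \<Rightarrow> 'a) \<Rightarrow> nat \<Rightarrow> nat \<Rightarrow> 'a"
  where "lift n g = (\<lambda>q\<in>{..<d ^ Suc n}.
    of_coords (\<lambda>i j. if j = 0 then coord (g (q div d)) i (Suc (q mod d)) else \<zero>))"

lemma coord_dif: "w < d ^ n \<Longrightarrow> coord (dif n f w) i j =
    (if j = 0 \<or> d < j then \<zero> else coord (f (w * d + (j - 1))) i 0)"
  by (simp add: dif_def)

lemma coord_eps: "coord (eps f) i j = (if j = 1 then coord (f 0) i 0 else \<zero>)"
  by (simp add: eps_def)

lemma coord_lift: "q < d ^ Suc n \<Longrightarrow>
    coord (lift n g q) i j = (if j = 0 then coord (g (q div d)) i (Suc (q mod d)) else \<zero>)"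
  by (simp add: lift_def)

lemma index_bound:
  assumes "w < d ^ n" "\<not> (j = 0 \<or> d < j)"
  shows "w * d + (j - 1) < d ^ Suc n"
proof -
  have "j - 1 < d" using assms(2) by linarith
  then have "w * d + (j - 1) < w * d + d" by (rule add_strict_left_mono)
  also have "\<dots> = Suc w * d" by simp
  also have "\<dots> \<le> d ^ n * d" using assms(1) by (intro mult_le_mono1) simp
  finally show ?thesis by (simp add: mult.commute)
qed

lemma div_bound: "q < d ^ Suc n \<Longrightarrow> q div d < d ^ n"
  by (rule less_mult_imp_div_less) (simp add: mult.commute)

lemma dif_closed:
  assumes "f \<in> carrier (P (Suc n))"
  shows "dif n f \<in> carrier (P n)"
proof -
  have "dif n f w \<in> carrier A" if w: "w < d ^ n" for w
  proof -
    have "f (w * d + (j - 1)) \<in> carrier A" if "\<not> (j = 0 \<or> d < j)" for j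
      by (rule P_closed[OF assms index_bound[OF w that]])
    then show ?thesis
      unfolding carrier_A coord_dif[OF w] by (auto simp: carrier_A)
  qed
  then show ?thesis by (simp add: P_carrier dif_def)
qed

lemma eps_closed:
  assumes "f \<in> carrier (P 0)"
  shows "eps f \<in> supp_in (col 0)"
proof -
  have "f 0 \<in> carrier A" using P_closed[OF assms, of 0] by simp
  then show ?thesis
    using d_pos by (auto simp: supp_in_def carrier_A coord_eps col_def)
qed

lemma lift_closed:
  assumes "g \<in> carrier (P n)"
  shows "lift n g \<in> carrier (P (Suc n))"
proof -
  have "lift n g q \<in> carrier A" if q: "q < d ^ Suc n" for q
    using P_closed[OF assms div_bound[OF q]]
    unfolding carrier_A coord_lift[OF q] by auto
  moreover have "lift n g \<in> extensional {..<d ^ Suc n}"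
    unfolding lift_def by (rule restrict_extensional)
  ultimately show ?thesis unfolding P_carrier by blast
qed

text \<open>The coefficients of \<open>dif n x\<close> without y vanish, so in the coordinate
  \<open>(i, j)\<close> of \<open>a\<close> times it only the y-free coefficients of
  \<open>a\<close> survive; they combine exactly as in the coordinate \<open>(i, 0)\<close> of
  \<open>a\<close> times the entry of \<open>x\<close>.\<close>

lemma dif_hom: "dif n \<in> mod_hom A (P (Suc n)) (P n)"
  unfolding mod_hom_def
proof (intro CollectI conjI ballI)
  show "dif n \<in> carrier (P (Suc n)) \<rightarrow> carrier (P n)"
    using dif_closed by blast
  fix x assume x: "x \<in> carrier (P (Suc n))"
  show "dif n (x \<oplus>\<^bsub>P (Suc n)\<^esub> y) = dif n x \<oplus>\<^bsub>P n\<^esub> dif n y" if y: "y \<in> carrier (P (Suc n))" for y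
  proof (rule P_ext)
    fix w i j assume w: "w < d ^ n"
    show "coord (dif n (x \<oplus>\<^bsub>P (Suc n)\<^esub> y) w) i j = coord ((dif n x \<oplus>\<^bsub>P n\<^esub> dif n y) w) i j"
    proof (cases "j = 0 \<or> d < j")
      case False
      from index_bound[OF w False] False show ?thesis
        by (simp only: P_apply[OF w] P_apply[OF index_bound[OF w False]] coord_dif[OF w] coord_A if_False)
    qed (simp add: w coord_dif)
  qed (simp_all only: dif_closed P_add_closed x y)
  fix a assume a: "a \<in> carrier A"
  show "dif n (a \<odot>\<^bsub>P (Suc n)\<^esub> x) = a \<odot>\<^bsub>P n\<^esub> dif n x"
  proof (rule P_ext)
    fix w i j assume w: "w < d ^ n"
    have dA: "dif n x w \<in> carrier A" by (rule P_closed[OF dif_closed[OF x] w])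
    show "coord (dif n (a \<odot>\<^bsub>P (Suc n)\<^esub> x) w) i j = coord ((a \<odot>\<^bsub>P n\<^esub> dif n x) w) i j"
    proof (cases "j = 0 \<or> d < j")
      case False
      note q = index_bound[OF w False]
      have xq: "x (w * d + (j - 1)) \<in> carrier A" by (rule P_closed[OF x q])
      have "coord (dif n (a \<odot>\<^bsub>P (Suc n)\<^esub> x) w) i j = coord (a \<otimes>\<^bsub>A\<^esub> x (w * d + (j - 1))) i 0"
        using False by (simp only: P_apply[OF q] coord_dif[OF w] if_False)
      moreover have "coord (dif n x w) i' j = coord (x (w * d + (j - 1))) i' 0"
        "coord (dif n x w) i' 0 = \<zero>" for i'
        using False by (simp_all only: coord_dif[OF w] if_False if_True simp_thms)
      then have "coord (a \<otimes>\<^bsub>A\<^esub> dif n x w) i j = coord (a \<otimes>\<^bsub>A\<^esub> x (w * d + (j - 1))) i 0"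
        unfolding coord_mult using False a coord_closed[OF xq] by simp
      ultimately show ?thesis by (simp add: w)
    next
      case True
      have "coord (a \<otimes>\<^bsub>A\<^esub> dif n x w) i 0 = \<zero>"
        using a by (simp add: coord_mult coord_dif[OF w])
      moreover have "coord (a \<otimes>\<^bsub>A\<^esub> dif n x w) i j = \<zero>" if "d < j"
        using a dA that by (metis A.m_closed carrier_A)
      ultimately show ?thesis using True w by (auto simp: coord_dif)
    qed
  qed (simp_all only: dif_closed P_smult_closed x a)
qed

lemma eps_hom: "eps \<in> mod_hom A (P 0) M"
  unfolding mod_hom_def
proof (intro CollectI conjI ballI)
  show "eps \<in> carrier (P 0) \<rightarrow> carrier M"
    using eps_closed by auto
  fix x assume x: "x \<in> carrier (P 0)"
  show "eps (x \<oplus>\<^bsub>P 0\<^esub> y) = eps x \<oplus>\<^bsub>M\<^esub> eps y" if y: "y \<in> carrier (P 0)" for y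
  proof -
    have "(x \<oplus>\<^bsub>P 0\<^esub> y) 0 = x 0 \<oplus>\<^bsub>A\<^esub> y 0"
      using P_apply(1)[of 0 0 x y] by simp
    then show ?thesis
      by (intro coord_ext) (simp add: coord_eps)
  qed
  fix a assume a: "a \<in> carrier A"
  have x0: "x 0 \<in> carrier A" using P_closed[OF x, of 0] by simp
  have "coord (a \<otimes>\<^bsub>A\<^esub> x 0) i 0 = coord (a \<otimes>\<^bsub>A\<^esub> eps x) i 1" for i
    using a x0 by (simp add: coord_mult coord_eps)
  moreover have "coord (a \<otimes>\<^bsub>A\<^esub> eps x) i j = \<zero>" if "j \<noteq> 1" for i j
    using supp_in_colD(2)[OF supp_in_mult[OF col_up_closed a eps_closed[OF x]] that] .
  moreover have "(a \<odot>\<^bsub>P 0\<^esub> x) 0 = a \<otimes>\<^bsub>A\<^esub> x 0"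
    using P_apply(2)[of 0 0 a x] by simp
  ultimately show "eps (a \<odot>\<^bsub>P 0\<^esub> x) = a \<odot>\<^bsub>M\<^esub> eps x"
    by (intro coord_ext) (simp add: coord_eps)
qed

text \<open>Quotient and remainder by \<open>d\<close> recover the word \<open>w\<close> and the
  letter \<open>j - 1\<close>, so dividing by the y_j and multiplying back loses only the y-free
  part.\<close>

lemma dif_lift:
  assumes "g \<in> carrier (P n)" "w < d ^ n"
  shows "coord (dif n (lift n g) w) i j = (if j = 0 then \<zero> else coord (g w) i j)"
proof (cases "j = 0 \<or> d < j")
  case False
  have "j - 1 < d" using False by linarith
  then have "(w * d + (j - 1)) div d = w" "(w * d + (j - 1)) mod d = j - 1"
    by (simp_all only: div_mult_self3 mod_mult_self3 div_less mod_less add_0_right)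
  then show ?thesis
    using False by (simp only: coord_dif[OF assms(2)] coord_lift[OF index_bound[OF assms(2) False]]) simp
next
  case True
  then show ?thesis
    using P_closed[OF assms] by (auto simp: coord_dif[OF assms(2)] carrier_A)
qed

lemma dif_filtP: "dif n ` filtP m (Suc n) \<subseteq> filtP (Suc m) n"
proof (rule image_subsetI)
  fix f assume f: "f \<in> filtP m (Suc n)"
  have "coord (dif n f w) i j = \<zero>" if w: "w < d ^ n" and "\<not> Suc m \<le> of_bool (i \<noteq> 0) + of_bool (j \<noteq> 0)" for w i j
  proof (cases "j = 0 \<or> d < j")
    case False
    then have "\<not> m \<le> of_bool (i \<noteq> 0)" using that by simp
    then show ?thesis
      using f index_bound[OF w False] False by (simp add: coord_dif[OF w] filtP_iff)
  qed (simp add: coord_dif[OF w])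
  then show "dif n f \<in> filtP (Suc m) n"
    using f dif_closed by (simp add: filtP_iff)
qed

lemma eps_filtP: "eps ` filtP m 0 \<subseteq> supp_in (col m)"
proof (rule image_subsetI)
  fix f assume f: "f \<in> filtP m 0"
  then show "eps f \<in> supp_in (col m)"
    using eps_closed[of f] by (auto simp: supp_in_def filtP_iff coord_eps col_def)
qed

lemma lift_filtP:
  assumes "g \<in> filtP (Suc m) n"
  shows "lift n g \<in> filtP m (Suc n)"
proof -
  have "coord (lift n g q) i j = \<zero>"
    if q: "q < d ^ Suc n" and "\<not> m \<le> of_bool (i \<noteq> 0) + of_bool (j \<noteq> 0)" for q i j
    using that(2) assms div_bound[OF q] by (auto simp: coord_lift[OF q] filtP_iff)
  then show ?thesis
    using assms lift_closed by (simp add: filtP_iff)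
qed

text \<open>Preimage of \<open>J\<^sup>m\<^sup>+\<^sup>1 P (n - 1)\<close> under \<open>dif (n - 1)\<close>, or of \<open>J\<^sup>m M\<close> under \<open>eps\<close> if
  \<open>n = 0\<close>.  For \<open>m = 2\<close> the bound \<open>m \<le> of_bool _\<close> never holds, and this is the kernel \<open>(y\<^sub>1, \<dots>, y\<^sub>d) P n\<close>.\<close>

definition kerP :: "nat \<Rightarrow> nat \<Rightarrow> (nat \<Rightarrow> nat \<Rightarrow> 'a) set"
  where "kerP m n = {f \<in> carrier (P n). \<forall>q<d ^ n. \<forall>i. \<not> m \<le> of_bool (i \<noteq> 0) \<longrightarrow> coord (f q) i 0 = \<zero>}"

section \<open>Kernels and images of the differentials\<close>

text \<open>\<open>dif\<close> discards all coefficients that involve a y and moves each y-free one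
  to a place of degree one higher; no two land in the same place.\<close>

lemma dif_in_filtP_iff:
  assumes f: "f \<in> carrier (P (Suc n))"
  shows "dif n f \<in> filtP (Suc m) n \<longleftrightarrow> f \<in> kerP m (Suc n)"
proof
  assume L: "dif n f \<in> filtP (Suc m) n"
  have "coord (f q) i 0 = \<zero>" if q: "q < d ^ Suc n" and i: "\<not> m \<le> of_bool (i \<noteq> 0)" for q i
  proof -
    \<comment> \<open>The y-free coefficients of entry \<open>q\<close> reappear in entry
      \<open>q div d\<close> at this second index; it is shifted by one because index 0 stands for
      the absence of a y.\<close>
    let ?j = "Suc (q mod d)"
    have j: "?j \<le> d" using d_pos by (simp add: Suc_le_eq)
    have "coord (dif n f (q div d)) i ?j = \<zero>"
      using L div_bound[OF q] i by (simp add: filtP_iff)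
    then show ?thesis
      using j by (simp add: coord_dif[OF div_bound[OF q]])
  qed
  then show "f \<in> kerP m (Suc n)" using f by (simp add: kerP_def)
next
  assume R: "f \<in> kerP m (Suc n)"
  have "coord (dif n f w) i j = \<zero>"
    if w: "w < d ^ n" and "\<not> Suc m \<le> of_bool (i \<noteq> 0) + of_bool (j \<noteq> 0)" for w i j
  proof (cases "j = 0 \<or> d < j")
    case False
    then have "\<not> m \<le> of_bool (i \<noteq> 0)" using that by simp
    then show ?thesis
      using R index_bound[OF w False] False by (simp add: coord_dif[OF w] kerP_def)
  qed (simp add: coord_dif[OF w])
  then show "dif n f \<in> filtP (Suc m) n"
    using f dif_closed by (simp add: filtP_iff)
qed

lemma eps_in_col_iff:
  assumes f: "f \<in> carrier (P 0)"
  shows "eps f \<in> supp_in (col m) \<longleftrightarrow> f \<in> kerP m 0"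
  using eps_closed[OF f] f by (auto simp: supp_in_def coord_eps col_def kerP_def)

text \<open>An element without y-free part is recovered from its quotients by the y_j, so
  \<open>lift\<close> gives the preimage.\<close>

lemma kerP_2: "kerP 2 n = dif n ` carrier (P (Suc n))"
proof (intro equalityI subsetI)
  fix f assume f: "f \<in> kerP 2 n"
  then have fP: "f \<in> carrier (P n)" by (simp add: kerP_def)
  have "dif n (lift n f) = f"
  proof (rule P_ext[OF dif_closed[OF lift_closed[OF fP]] fP])
    fix w i j assume w: "w < d ^ n"
    show "coord (dif n (lift n f) w) i j = coord (f w) i j"
      using f w by (simp add: dif_lift[OF fP w] kerP_def)
  qed
  then show "f \<in> dif n ` carrier (P (Suc n))"
    using lift_closed[OF fP] by (metis imageI)
next
  fix f assume "f \<in> dif n ` carrier (P (Suc n))"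
  then show "f \<in> kerP 2 n"
    using dif_closed by (auto simp: kerP_def coord_dif)
qed

text \<open>Injectivity at the left end of a layer sequence: the layer J^0 P / J P sees only the
  constant coefficient, which no y_j annihilates.\<close>

lemma kerP_filtP_0: "filtP 0 n \<inter> kerP 1 n = filtP 1 n"
  by (auto simp: filtP_iff kerP_def)

text \<open>Exactness in the middle of a layer sequence, in terms of cosets: the left side is the
  kernel of the outgoing map, the right side the image of the incoming one.\<close>

lemma kerP_coset:
  "(\<lambda>x. filtP (Suc (Suc m)) n +>\<^bsub>P n\<^esub> x) ` (filtP (Suc m) n \<inter> kerP (Suc (Suc m)) n) =
   (\<lambda>x. filtP (Suc (Suc m)) n +>\<^bsub>P n\<^esub> dif n x) ` filtP m (Suc n)"
proof (intro equalityI image_subsetI)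
  fix x assume x: "x \<in> filtP (Suc m) n \<inter> kerP (Suc (Suc m)) n"
  then have xP: "x \<in> carrier (P n)" by (simp add: kerP_def)
  \<comment> \<open>The y-free part of \<open>x\<close>. Membership in \<open>kerP\<close> puts it
    into the next power of the radical, and the rest of \<open>x\<close> is the boundary
    \<open>dif n (lift n x)\<close>.\<close>
  define s where "s = (\<lambda>w\<in>{..<d ^ n}. of_coords (\<lambda>i j. if j = 0 then coord (x w) i 0 else \<zero>))"
  have cs: "coord (s w) i j = (if j = 0 then coord (x w) i 0 else \<zero>)" if "w < d ^ n" for w i j
    using that by (simp add: s_def)
  have "s w \<in> carrier A" if "w < d ^ n" for w
    unfolding carrier_A cs[OF that] using P_closed[OF xP that] by (auto simp: carrier_A)
  then have sP: "s \<in> carrier (P n)" by (simp add: P_carrier s_def)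
  have "s \<in> filtP (Suc (Suc m)) n"
    unfolding filtP_iff using sP x by (auto simp: cs kerP_def)
  moreover have dP: "dif n (lift n x) \<in> carrier (P n)"
    by (intro dif_closed lift_closed xP)
  moreover have "x = s \<oplus>\<^bsub>P n\<^esub> dif n (lift n x)"
  proof (rule P_ext[OF xP P_add_closed[OF sP dP]])
    fix w i j assume w: "w < d ^ n"
    then show "coord (x w) i j = coord ((s \<oplus>\<^bsub>P n\<^esub> dif n (lift n x)) w) i j"
      using P_closed[OF xP w] by (simp add: cs dif_lift[OF xP])
  qed
  ultimately have "filtP (Suc (Suc m)) n +>\<^bsub>P n\<^esub> x = filtP (Suc (Suc m)) n +>\<^bsub>P n\<^esub> dif n (lift n x)"
    using left_module.coset_eqI[OF P_left_module filtP_submodule] by metis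
  then show "filtP (Suc (Suc m)) n +>\<^bsub>P n\<^esub> x \<in> (\<lambda>x. filtP (Suc (Suc m)) n +>\<^bsub>P n\<^esub> dif n x) ` filtP m (Suc n)"
    using x lift_filtP by blast
next
  fix x assume x: "x \<in> filtP m (Suc n)"
  then have "dif n x \<in> filtP (Suc m) n" using dif_filtP by blast
  moreover have "dif n x \<in> kerP (Suc (Suc m)) n"
    using dif_closed[of x n] x by (auto simp: kerP_def coord_dif filtP_iff)
  ultimately show "filtP (Suc (Suc m)) n +>\<^bsub>P n\<^esub> dif n x \<in>
      (\<lambda>x. filtP (Suc (Suc m)) n +>\<^bsub>P n\<^esub> x) ` (filtP (Suc m) n \<inter> kerP (Suc (Suc m)) n)"
    by blast
qed

lemma eps_image: "eps ` filtP m 0 = supp_in (col m)"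
proof (intro equalityI subsetI)
  fix x assume x: "x \<in> supp_in (col m)"
  \<comment> \<open>Division of \<open>x\<close> by y_1.\<close>
  define f where "f = (\<lambda>w\<in>{..<d ^ 0}. of_coords (\<lambda>i j. if j = 0 then coord x i 1 else \<zero>))"
  have coord_f: "coord (f 0) i j = (if j = 0 then coord x i 1 else \<zero>)" for i j
    by (simp add: f_def)
  have "f 0 \<in> carrier A"
    unfolding carrier_A coord_f using supp_in_carrier[OF x] by (auto simp: carrier_A)
  moreover have "f \<in> extensional {..<d ^ 0}"
    unfolding f_def by (rule restrict_extensional)
  ultimately have "f \<in> carrier (P 0)" unfolding P_carrier by simp
  then have "f \<in> filtP m 0"
    unfolding filtP_iff using x by (auto simp: coord_f supp_in_def col_def)
  moreover have "eps f = x"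
    using x by (intro coord_ext) (auto simp: coord_eps coord_f supp_in_def col_def)
  ultimately show "x \<in> eps ` filtP m 0" by blast
qed (use eps_filtP in blast)

lemma filtP_3: "filtP 3 n = {\<zero>\<^bsub>P n\<^esub>}"
proof -
  interpret P: left_module A "P n" by (rule P_left_module)
  have "f = \<zero>\<^bsub>P n\<^esub>" if "f \<in> filtP 3 n" for f
    using that by (intro P_ext[of _ n]) (auto simp: filtP_def filt_ge_3 supp_in_empty)
  then show ?thesis using P.submoduleD(2)[OF filtP_submodule] by blast
qed

text \<open>Since J^3 = 0, vanishing of the image is the case \<open>m = 2\<close> of
  \<open>dif_in_filtP_iff\<close>.\<close>

lemma dif_kernel: "a_kernel (P (Suc n)) (P n) (dif n) = kerP 2 (Suc n)"
proof -
  have "dif n f = \<zero>\<^bsub>P n\<^esub> \<longleftrightarrow> f \<in> kerP 2 (Suc n)" if "f \<in> carrier (P (Suc n))" for f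
  proof -
    have "filtP (Suc 2) n = {\<zero>\<^bsub>P n\<^esub>}" using filtP_3[of n] by (simp add: eval_nat_numeral)
    then show ?thesis using dif_in_filtP_iff[OF that, of 2] by (simp only: singleton_iff)
  qed
  then show ?thesis
    by (auto simp: a_kernel_def kernel_def kerP_def)
qed

lemma eps_kernel: "a_kernel (P 0) M eps = kerP 2 0"
proof -
  have "col 2 = {}" by (auto simp: col_def)
  then have "eps f = \<zero>\<^bsub>A\<^esub> \<longleftrightarrow> f \<in> kerP 2 0" if "f \<in> carrier (P 0)" for f
    using eps_in_col_iff[OF that, of 2] by (simp add: supp_in_empty)
  then show ?thesis
    by (auto simp: a_kernel_def kernel_def kerP_def)
qed

lemma kerP_2_filtP_1: "kerP 2 n \<subseteq> filtP 1 n"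
  by (auto simp: filtP_iff kerP_def)

lemma resolution: "minimal_projective_resolution A M P dif eps"
  unfolding minimal_projective_resolution_def
proof (intro conjI allI)
  show "eps ` carrier (P 0) = carrier M"
    using eps_image[of 0] by (simp add: filtP_0)
  show "dif 0 ` carrier (P 1) = a_kernel (P 0) M eps"
    using eps_kernel kerP_2[of 0] by simp
  show "dif (Suc i) ` carrier (P (Suc (Suc i))) = a_kernel (P (Suc i)) (P i) (dif i)" for i
    using dif_kernel kerP_2 by simp
  show "superfluous A (P 0) (a_kernel (P 0) M eps)"
    unfolding eps_kernel by (intro superfluous_P kerP_2_filtP_1)
  show "superfluous A (P (Suc i)) (a_kernel (P (Suc i)) (P i) (dif i))" for i
    unfolding dif_kernel by (intro superfluous_P kerP_2_filtP_1)
qed (simp_all only: free_module_projective[OF A.ring_axioms] eps_hom dif_hom)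

section \<open>Exactness of the layer sequences\<close>

lemma dif_layer_image:
  "induced_map (P n) (filtP (Suc m') n) (dif n) ` carrier (quot_mod (P (Suc n)\<lparr>carrier := filtP m (Suc n)\<rparr>) (filtP m' (Suc n))) =
    (\<lambda>x. filtP (Suc m') n +>\<^bsub>P n\<^esub> dif n x) ` filtP m (Suc n)"
  by (rule left_module.induced_map_image[OF P_left_module dif_hom filtP_submodule filtP_submodule
        P_left_module dif_filtP filtP_carrier])

lemma dif_layer_kernel:
  "a_kernel (quot_mod (P (Suc n)\<lparr>carrier := filtP m (Suc n)\<rparr>) (filtP m' (Suc n)))
      (quot_mod (P n\<lparr>carrier := X\<rparr>) (filtP (Suc m') n)) (induced_map (P n) (filtP (Suc m') n) (dif n)) =
    (\<lambda>x. filtP m' (Suc n) +>\<^bsub>P (Suc n)\<^esub> x) ` (filtP m (Suc n) \<inter> kerP m' (Suc n))"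
proof -
  have "{x \<in> filtP m (Suc n). dif n x \<in> filtP (Suc m') n} = filtP m (Suc n) \<inter> kerP m' (Suc n)"
    using filtP_carrier[of m "Suc n"] dif_in_filtP_iff by blast
  then show ?thesis
    using left_module.induced_map_kernel[OF P_left_module dif_hom filtP_submodule filtP_submodule
        P_left_module dif_filtP filtP_carrier] by simp
qed

lemma M_submodule: "submodule (supp_in (col m)) A M"
  unfolding M_def reg.submodule_restrict_iff[OF supp_in_submodule[OF col_up_closed]]
  using supp_in_submodule[OF col_up_closed] supp_in_mono[OF col_mono] by simp

lemma eps_layer_kernel:
  "a_kernel (quot_mod (P 0\<lparr>carrier := filtP m 0\<rparr>) (filtP m' 0))
      (quot_mod (M\<lparr>carrier := X\<rparr>) (supp_in (col m'))) (induced_map M (supp_in (col m')) eps) =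
    (\<lambda>x. filtP m' 0 +>\<^bsub>P 0\<^esub> x) ` (filtP m 0 \<inter> kerP m' 0)"
proof -
  have "{x \<in> filtP m 0. eps x \<in> supp_in (col m')} = filtP m 0 \<inter> kerP m' 0"
    using filtP_carrier[of m 0] eps_in_col_iff by blast
  then show ?thesis
    using left_module.induced_map_kernel[OF M_left_module eps_hom M_submodule filtP_submodule
        P_left_module eps_filtP filtP_carrier] by simp
qed

lemma kerP_coset_0: "(\<lambda>x. filtP 1 n +>\<^bsub>P n\<^esub> x) ` (filtP 0 n \<inter> kerP 1 n) = {filtP 1 n}"
proof -
  interpret P: left_module A "P n" by (rule P_left_module)
  interpret J: abelian_subgroup "filtP 1 n" "P n"
    by (rule P.abelian_subgroup_submodule[OF filtP_submodule])
  have "(\<lambda>x. filtP 1 n +>\<^bsub>P n\<^esub> x) ` filtP 1 n = (\<lambda>_. filtP 1 n) ` filtP 1 n"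
    by (rule image_cong[OF refl J.a_rcos_const])
  then show ?thesis
    unfolding kerP_filtP_0 using J.zero_closed by (simp add: image_constant[of "\<zero>\<^bsub>P n\<^esub>"])
qed

text \<open>The kernels of the maps induced by \<open>eps\<close> and by \<open>dif\<close> have the
  same description through \<open>kerP\<close>; hence the single equation \<open>eq\<close> settles
  every term of a free module, while exactness at the module is \<open>eps_image\<close>.\<close>

lemma layers_exact: "layer_sequence_exact A M P dif eps n"
proof -
  have eq: "(\<lambda>x. filtP (Suc (n - i)) i +>\<^bsub>P i\<^esub> x) ` (filtP (n - i) i \<inter> kerP (Suc (n - i)) i) =
      (if i = n then {\<zero>\<^bsub>layer A (n - n) (P n)\<^esub>} else
        induced_map (P i) (rad_mod A (Suc (n - i)) (P i)) (dif i) ` carrier (layer A (n - Suc i) (P (Suc i))))"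
    if "i \<le> n" for i
  proof (cases "i = n")
    case True
    then show ?thesis
      using kerP_coset_0[of n]
      by (simp only: layer_def zero_quot_mod rad_mod_P diff_self_eq_0 One_nat_def if_True simp_thms)
  next
    case False
    \<comment> \<open>Here \<open>i < n\<close>, so the layer has positive degree and
      \<open>kerP_coset\<close> applies with \<open>n - Suc i\<close> for its
      \<open>m\<close>.\<close>
    then have m: "n - i = Suc (n - Suc i)" using that by simp
    show ?thesis
      unfolding layer_def rad_mod_P m dif_layer_image using kerP_coset False by simp
  qed
  show ?thesis
    unfolding layer_sequence_exact_def Let_def
  proof (intro conjI allI impI)
    show "induced_map M (rad_mod A (Suc n) M) eps ` carrier (layer A (n - 0) (P 0)) = carrier (layer A n M)"
      unfolding layer_def rad_mod_P rad_mod_M diff_zero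
        left_module.induced_map_image[OF M_left_module eps_hom M_submodule filtP_submodule
          P_left_module eps_filtP filtP_carrier]
      by (simp only: carrier_quot_mod_restrict eps_image[symmetric] image_image)
    show "a_kernel (layer A (n - 0) (P 0)) (layer A n M) (induced_map M (rad_mod A (Suc n) M) eps) =
      (if 0 = n then {\<zero>\<^bsub>layer A (n - n) (P n)\<^esub>} else
        induced_map (P 0) (rad_mod A (Suc (n - 0)) (P 0)) (dif 0) ` carrier (layer A (n - Suc 0) (P (Suc 0))))"
      unfolding eq[of 0, OF le0, symmetric]
      unfolding layer_def rad_mod_P rad_mod_M diff_zero eps_layer_kernel ..
    fix i assume i: "i < n"
    \<comment> \<open>The source layer is taken modulo degree \<open>n - i\<close> and the target
      layer modulo degree \<open>Suc (n - i)\<close>, the shift by one that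
      \<open>dif_layer_kernel\<close> expects.\<close>
    then have Suc: "Suc (n - Suc i) = n - i" by simp
    show "a_kernel (layer A (n - Suc i) (P (Suc i))) (layer A (n - i) (P i))
        (induced_map (P i) (rad_mod A (Suc (n - i)) (P i)) (dif i)) =
      (if Suc i = n then {\<zero>\<^bsub>layer A (n - n) (P n)\<^esub>} else
        induced_map (P (Suc i)) (rad_mod A (Suc (n - Suc i)) (P (Suc i))) (dif (Suc i)) `
          carrier (layer A (n - Suc (Suc i)) (P (Suc (Suc i)))))"
      unfolding eq[of "Suc i", OF Suc_leI[OF i], symmetric]
      unfolding layer_def rad_mod_P Suc dif_layer_kernel ..
  qed
qed

lemma M_koszul: "koszul_module A M"
  unfolding koszul_module_def
  using M_left_module M_length resolution layers_exact by blast

end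

theorem theorem6:
  fixes K :: "('k, 'x) ring_scheme" and c d e a :: nat
  assumes "field K" and "c > 0" and "d > 0" and "e = c + d" and "a = c * d"
  shows "\<exists>A :: ('k, nat \<Rightarrow> 'k) module.
    short_local_algebra K A \<and> cring A \<and> hilbert_type A (e, a) \<and>
    (\<exists>M :: (nat \<Rightarrow> 'k, nat \<Rightarrow> 'k) module.
      koszul_module A M \<and> loewy_length_at_most A M 2 \<and> dimension_vector A M (1, c))"
proof -
  interpret two_blocks K c d
    using assms by (simp add: two_blocks_def two_blocks_axioms_def)
  show ?thesis
    using A_short_local A_cring A_hilbert_type M_koszul M_loewy M_dimension_vector assms by blast
qed

end
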